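(* For every $\lambda\in\mathbb{C}$ with $|\lambda|<\frac{a}{2n_-}$ and every $k\in\{0,1,2\}$, the Jost solution at $-\infty$, i.e. a solution $u_k(\lambda,x)$ of $iy'''(x)=m(x)\lambda^3y(x)$ ($x\in\mathbb{R}$) with $u_k(\lambda,x)-e^{iz_-\zeta_kx}\to0$ as $x\to-\infty$ ($z_-=\lambda n_-$), exists and is given by $$u_k(\lambda,x)=e^{iz_-\zeta_kx}+\int_{-\infty}^x\widehat N(z_-,x,t)\left(\frac{m(t)}{m_-}-1\right)e^{iz_-\zeta_kt}dt,$$ where $\widehat N(z,x,t)=\sum_{n=1}^\infty(iz)^n\widehat K_n(z,x,t)$.
   Context: Setting: $m:\mathbb{R}\to\mathbb{R}$ is a measurable function having limits $m_\pm=\lim_{x\to\pm\infty}m(x)$ with $0<m_\pm<\infty$, and there is $a>0$ with $\int_{\mathbb{R}_\pm}|m(x)-m_\pm|^2e^{2a|x|}dx<\infty$. Put $n_\pm=m_\pm^{1/3}>0$. Let $\zeta_0=1$, $\zeta_1=\frac12(-1+i\sqrt3)$, $\zeta_2=\frac12(-1-i\sqrt3)$ and $s_2(z)=\frac13\left(e^{\zeta_0z}+\zeta_1^{-2}e^{\zeta_1z}+\zeta_2^{-2}e^{\zeta_2z}\right)$. Solutions of the equation are understood with $y,y',y''$ locally absolutely continuous and the equation holding a.e. The kernels $\widehat K_n(z,x,t)$, $t\le x$, are $\widehat K_1(z,x,t)=s_2(iz(x-t))$ and $\widehat K_{n+1}(z,x,t)=\int_t^x\widehat K_n(z,x,s)\left(\frac{m(s)}{m_-}-1\right)\widehat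 K_1(z,s,t)ds$ (the kernels of the powers of the Volterra operator $f\mapsto\int_{-\infty}^x\widehat K_1(z,x,t)\left(\frac{m(t)}{m_-}-1\right)f(t)dt$). *)

theory Defs
  imports "HOL-Analysis.Analysis"
begin

text \<open>Absolute continuity of functions is not in the library (\<open>absolutely_continuous\<close> there is
  about measures).\<close>

definition abs_continuous_on_Icc :: "(real \<Rightarrow> complex) \<Rightarrow> real \<Rightarrow> real \<Rightarrow> bool" where
  "abs_continuous_on_Icc f c d \<longleftrightarrow>
     (\<forall>\<epsilon>>0. \<exists>\<delta>>0. \<forall>(n::nat) (l::nat \<Rightarrow> real) (r::nat \<Rightarrow> real).
        (\<forall>i<n. c \<le> l i \<and> l i \<le> r i \<and> r i \<le> d) \<and>
        disjoint_family_on (\<lambda>i. {l i<..<r i}) {..<n} \<and>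
        (\<Sum>i<n. r i - l i) < \<delta>
        \<longrightarrow> (\<Sum>i<n. norm (f (r i) - f (l i))) < \<epsilon>)"

definition locally_abs_continuous :: "(real \<Rightarrow> complex) \<Rightarrow> bool" where
  "locally_abs_continuous f \<longleftrightarrow> (\<forall>c d. c \<le> d \<longrightarrow> abs_continuous_on_Icc f c d)"

text \<open>Solutions of \<open>\<i> y''' = m l\<^sup>3 y\<close> on the real line; \<open>y1\<close> and \<open>y2\<close> are \<open>y'\<close> and \<open>y''\<close>.\<close>

definition is_solution :: "(real \<Rightarrow> real) \<Rightarrow> complex \<Rightarrow> (real \<Rightarrow> complex) \<Rightarrow> bool" where
  "is_solution m l y \<longleftrightarrow>
     (\<exists>y1 y2. (\<forall>x. (y has_vector_derivative y1 x) (at x)) \<and>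
              (\<forall>x. (y1 has_vector_derivative y2 x) (at x)) \<and>
              locally_abs_continuous y \<and> locally_abs_continuous y1 \<and> locally_abs_continuous y2 \<and>
              (AE x in lebesgue. \<exists>y3. (y2 has_vector_derivative y3) (at x) \<and>
                                       \<i> * y3 = of_real (m x) * l ^ 3 * y x))"

definition zeta :: "nat \<Rightarrow> complex" where
  "zeta k = (if k = 0 then 1
             else if k = 1 then (-1 + \<i> * of_real (sqrt 3)) / 2
             else (-1 - \<i> * of_real (sqrt 3)) / 2)"

definition s2 :: "complex \<Rightarrow> complex" where
  "s2 z = (exp (zeta 0 * z) + zeta 1 powi (-2) * exp (zeta 1 * z)
           + zeta 2 powi (-2) * exp (zeta 2 * z)) / 3"

text \<open>A Jost solution at \<open>-\<infinity>\<close>, where \<open>mm\<close> is the limit of \<open>m\<close> at \<open>-\<infinity>\<close>. In general the asymptotic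
  condition does not determine \<open>u\<close> uniquely, as there may be nonzero solutions decaying
  at \<open>-\<infinity>\<close>.\<close>

definition is_jost_minus ::
    "(real \<Rightarrow> real) \<Rightarrow> real \<Rightarrow> complex \<Rightarrow> nat \<Rightarrow> (real \<Rightarrow> complex) \<Rightarrow> bool" where
  "is_jost_minus m mm l k u \<longleftrightarrow>
     is_solution m l u \<and>
     ((\<lambda>x. u x - exp (\<i> * (l * of_real (root 3 mm)) * zeta k * of_real x)) \<longlongrightarrow> 0) at_bot"

text \<open>The kernels are indexed from 1; the value at index 0 is a dummy.\<close>

fun Khat :: "(real \<Rightarrow> real) \<Rightarrow> real \<Rightarrow> nat \<Rightarrow> complex \<Rightarrow> real \<Rightarrow> real \<Rightarrow> complex" where
  "Khat m mm 0 z x t = 0"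
| "Khat m mm (Suc 0) z x t = s2 (\<i> * z * of_real (x - t))"
| "Khat m mm (Suc (Suc n)) z x t =
     (LINT s:{t..x}|lebesgue.
        Khat m mm (Suc n) z x s * of_real (m s / mm - 1) * s2 (\<i> * z * of_real (s - t)))"

definition Nhat :: "(real \<Rightarrow> real) \<Rightarrow> real \<Rightarrow> complex \<Rightarrow> real \<Rightarrow> real \<Rightarrow> complex" where
  "Nhat m mm z x t = (\<Sum>n. (\<i> * z) ^ Suc n * Khat m mm (Suc n) z x t)"

end

theory Submission
  imports Defs
begin

text \<open>Write \<open>w = \<i> z\<close>, \<open>c = \<bar>z\<bar>\<close> and \<open>q = m / m\<^sub>- - 1\<close>. The equation is \<open>y''' - w\<^sup>3 y = w\<^sup>3 q y\<close>, and
  \<open>s2 (w x) / w\<^sup>2\<close> is the fundamental solution of its left-hand side, so a Jost solution is a solution of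
  \<open>y = f + w T y\<close>, where \<open>f\<close> is the plane wave and \<open>T\<close> the Volterra operator with kernel
  \<open>s2 (w (x - t)) q t\<close>. Since \<open>2 c < a\<close>, the Cauchy-Schwarz inequality makes \<open>q t exp (2 c \<bar>t\<bar>)\<close>
  integrable on left half-lines. This weight absorbs both the growth \<open>exp (c (x - t))\<close> of the kernel and
  the growth \<open>exp (c \<bar>t\<bar>)\<close> of \<open>f\<close>, so the Neumann series \<open>\<Sum>n. w ^ n T ^ n f\<close> converges and, by
  Fubini's theorem, can be resummed into the resolvent kernel. Finally \<open>T y\<close> is a combination of
  functions \<open>F\<^sub>j\<close> with \<open>F\<^sub>j' = w \<zeta>\<^sub>j F\<^sub>j + q y\<close> almost everywhere; the relations \<open>\<Sum>j. \<zeta>\<^sub>j = 0\<close> and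
  \<open>\<Sum>j. \<zeta>\<^sub>j\<^sup>2 = 0\<close> cancel the inhomogeneity in the first two derivatives of \<open>y\<close>.\<close>

subsection \<open>Lebesgue differentiation\<close>

text \<open>Three obstacles shape the proof. The coefficient is only integrable, so
  \<open>y'''\<close> exists merely almost everywhere and the pointwise product rule is out of
  reach. Calculus is therefore done with pairs of a function and an integrand of which it is a
  primitive: the product rule becomes an instance of Fubini's theorem, local absolute continuity
  holds for every primitive, and the differentiation theorem below, applied to \<open>y''\<close>,
  gives the equation almost everywhere. Next, the series must converge although
  \<open>\<bar>w\<bar>\<close> times the size of \<open>T\<close> need not be small. A weight
  adapted to \<open>q\<close> makes the ratio of the kernel bounds as small as desired, and
  \<open>1 / (2 * (norm w + 1))\<close> beats the powers of \<open>w\<close>. Finally,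
  \<open>m\<close> is only Lebesgue measurable, while Fubini's theorem is applied to Borel
  functions. So \<open>q\<close> is a Borel function that agrees with
  \<open>m / m\<^sub>- - 1\<close> almost everywhere, which leaves all kernels unchanged. The decay
  condition at \<open>+\<infinity>\<close> supplies the local integrability of \<open>q\<close> on
  the right half-line, so that the solution exists on the whole line.\<close>

text \<open>Dominated convergence, since each point eventually leaves the exceptional set. This
  splits \<open>g\<close> into a part bounded by \<open>M\<close> with support in
  \<open>{-M..M}\<close> and a remainder of small integral; absolute continuity of primitives and
  the weight for the iterated kernels both rest on the splitting.\<close>

lemma integrable_small_truncation:
  fixes g :: "real \<Rightarrow> real"
  assumes g: "integrable lborel g" and "0 < e"
  obtains M where "0 < M" "(LINT t|lborel. indicator {t. M < \<bar>g t\<bar> \<or> M < \<bar>t\<bar>} t * \<bar>g t\<bar>) \<le> e"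
proof -
  have [measurable]: "g \<in> borel_measurable borel"
    using borel_measurable_integrable[OF g] by simp
  let ?s = "\<lambda>n t. indicator {t. real n < \<bar>g t\<bar> \<or> real n < \<bar>t\<bar>} t * \<bar>g t\<bar>"
  have "(\<lambda>n. LINT t|lborel. ?s n t) \<longlonglongrightarrow> (LINT t::real|lborel. 0::real)"
  proof (rule integral_dominated_convergence)
    show "integrable lborel (\<lambda>t. \<bar>g t\<bar>)" using g by simp
    show "AE t in lborel. (\<lambda>n. ?s n t) \<longlonglongrightarrow> 0"
    proof (rule AE_I2)
      fix t
      obtain N where N: "max \<bar>g t\<bar> \<bar>t\<bar> \<le> real N" using real_arch_simple by blast
      have "eventually (\<lambda>n. ?s n t = 0) sequentially"
        using eventually_ge_at_top[of N]
      proof eventually_elim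
        case (elim n)
        then have "real N \<le> real n" by simp
        with N have "\<not> (real n < \<bar>g t\<bar> \<or> real n < \<bar>t\<bar>)" by auto
        then show ?case by simp
      qed
      then show "(\<lambda>n. ?s n t) \<longlonglongrightarrow> 0" by (rule tendsto_eventually)
    qed
    show "AE t in lborel. norm (?s n t) \<le> \<bar>g t\<bar>" for n
      by (auto split: split_indicator)
  qed (use g in auto)
  then have "(\<lambda>n. LINT t|lborel. ?s n t) \<longlonglongrightarrow> 0" by simp
  then have "eventually (\<lambda>n. (LINT t|lborel. ?s n t) < e) sequentially"
    using \<open>0 < e\<close> by (rule order_tendstoD)
  then have "eventually (\<lambda>n. (LINT t|lborel. ?s n t) < e \<and> n > 0) sequentially"
    using eventually_gt_at_top[of 0] by eventually_elim auto
  then obtain n where "(LINT t|lborel. ?s n t) < e" "n > 0"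
    unfolding eventually_sequentially by blast
  then show ?thesis using that[of "real n"] by simp
qed

text \<open>Henstock's lemma bounds the total length of any finite disjoint family of intervals on which
  the difference quotient is off by more than \<open>e\<close>, and Vitali's theorem covers the exceptional
  points by such families.\<close>

lemma negligible_violating_points:
  fixes f F :: "real \<Rightarrow> 'a::euclidean_space"
  assumes f: "f integrable_on {a..b}"
    and F: "\<And>x y. \<lbrakk>a \<le> x; x \<le> y; y \<le> b\<rbrakk> \<Longrightarrow> F y - F x = integral {x..y} f"
    and "0 < e"
  shows "negligible {x \<in> {a<..<b}. \<forall>d>0. \<exists>y. y \<noteq> x \<and> \<bar>y - x\<bar> < d \<and>
           e * \<bar>y - x\<bar> < norm (F y - F x - (y - x) *\<^sub>R f x)}" (is "negligible ?E")
  unfolding negligible_outer_le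
proof (intro allI impI)
  fix \<eta> :: real assume "0 < \<eta>"
  \<comment> \<open>Each chosen interval will have a Henstock error of more than \<open>e\<close>
    times its length, so a total error below \<open>e * \<eta>\<close> keeps the total length below
    \<open>\<eta>\<close>.\<close>
  obtain \<gamma> where "gauge \<gamma>" and \<gamma>: "\<And>p. \<lbrakk>p tagged_partial_division_of (cbox a b); \<gamma> fine p\<rbrakk> \<Longrightarrow>
             sum (\<lambda>(x,k). norm (measure lborel k *\<^sub>R f x - integral k f)) p < e * \<eta>"
    using Henstock_lemma[of f a b "e * \<eta>"] f \<open>0 < e\<close> \<open>0 < \<eta>\<close> by auto
  define I where "I = (\<lambda>(x::real, y). {min x y..max x y})"
  \<comment> \<open>An index is an exceptional point \<open>x\<close> with a witness
    \<open>y\<close>. The point \<open>x\<close> is an end of the interval and serves as its tag;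
    midpoints \<open>c\<close> and radii \<open>r\<close> present the intervals as balls, as
    Vitali's theorem requires.\<close>
  define K where "K = {(x, y). x \<in> ?E \<and> y \<noteq> x \<and> I (x, y) \<subseteq> {a..b} \<and> I (x, y) \<subseteq> \<gamma> x \<and>
           e * \<bar>y - x\<bar> < norm (F y - F x - (y - x) *\<^sub>R f x)}"
  define c r where "c = (\<lambda>(x::real, y). (x + y) / 2)" and "r = (\<lambda>(x::real, y). \<bar>y - x\<bar> / 2)"
  have I: "cball (c i) (r i) = I i" for i
    by (cases i) (auto simp: c_def r_def I_def cball_eq_atLeastAtMost min_def max_def abs_if field_simps)
  obtain C where C: "countable C" "C \<subseteq> K"
     "pairwise (\<lambda>i j. disjnt (cball (c i) (r i)) (cball (c j) (r j))) C"
     "negligible (?E - (\<Union>i \<in> C. cball (c i) (r i)))"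
  proof (rule Vitali_covering_theorem_cballs)
    show "0 < r i" if "i \<in> K" for i using that by (auto simp: K_def r_def)
    fix x d :: real assume x: "x \<in> ?E" and "0 < d"
    obtain \<rho> where "\<rho> > 0" and \<rho>: "ball x \<rho> \<subseteq> \<gamma> x"
      using \<open>gauge \<gamma>\<close> by (meson gaugeD open_contains_ball)
    obtain y where y: "y \<noteq> x" "\<bar>y - x\<bar> < Min {d, \<rho>, x - a, b - x}"
        "e * \<bar>y - x\<bar> < norm (F y - F x - (y - x) *\<^sub>R f x)"
    proof -
      have "Min {d, \<rho>, x - a, b - x} > 0" using x \<open>d > 0\<close> \<open>\<rho> > 0\<close> by auto
      then show ?thesis using x that by blast
    qed
    have "I (x, y) \<subseteq> ball x \<rho>" "I (x, y) \<subseteq> {a..b}"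
      using y(2) by (auto simp: I_def dist_real_def)
    then have "(x, y) \<in> K" using x y \<rho> by (auto simp: K_def)
    moreover have "x \<in> I (x, y)" by (auto simp: I_def)
    ultimately show "\<exists>i. i \<in> K \<and> x \<in> cball (c i) (r i) \<and> r i < d"
      unfolding I using y(2) by (intro exI[of _ "(x, y)"]) (auto simp: r_def)
  qed
  have disj: "I i \<inter> I j = {}" if "i \<in> C" "j \<in> C" "i \<noteq> j" for i j
    using C(3) that unfolding pairwise_def I disjnt_def by blast
  \<comment> \<open>Henstock's lemma speaks of finite families; a bound uniform in \<open>D\<close>
    passes to the countable family \<open>C\<close>.\<close>
  have small: "measure lebesgue (\<Union>i\<in>D. I i) \<le> \<eta>" if D: "D \<subseteq> C" "finite D" for D
  proof -
    define p where "p = (\<lambda>i. (fst i, I i)) ` D"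
    have inj: "inj_on (\<lambda>i. (fst i, I i)) D"
    proof (rule inj_onI)
      fix i j assume "i \<in> D" "j \<in> D" "(fst i, I i) = (fst j, I j)"
      moreover have "fst i \<in> I i" by (auto simp: I_def split: prod.split)
      ultimately show "i = j" using disj[of i j] D by auto
    qed
    have p: "p tagged_partial_division_of (cbox a b)"
      unfolding tagged_partial_division_of_def
    proof (intro conjI allI impI)
      show "finite p" using D by (simp add: p_def)
    next
      fix x k assume "(x, k) \<in> p"
      then obtain i where i: "i \<in> D" "x = fst i" "k = I i" by (auto simp: p_def)
      then have "i \<in> K" using D C by auto
      then show "x \<in> k" "k \<subseteq> cbox a b" "\<exists>a b. k = cbox a b"
        using i by (auto simp: K_def I_def)
    next
      fix x1 k1 x2 k2 assume *: "(x1, k1) \<in> p \<and> (x2, k2) \<in> p \<and> (x1, k1) \<noteq> (x2, k2)"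
      then obtain i j where "i \<in> D" "j \<in> D" "k1 = I i" "k2 = I j" "i \<noteq> j" by (auto simp: p_def)
      then have "k1 \<inter> k2 = {}" using disj D by blast
      then show "interior k1 \<inter> interior k2 = {}" using interior_subset by blast
    qed
    have "I i \<subseteq> \<gamma> (fst i)" if "i \<in> D" for i
    proof -
      have "i \<in> K" using that D C by auto
      then show ?thesis by (cases i) (auto simp: K_def)
    qed
    then have fine: "\<gamma> fine p" unfolding fine_def p_def by auto
    have meas: "measure lebesgue (I i) = \<bar>snd i - fst i\<bar>" for i
      by (auto simp: I_def split: prod.split)
    have "e * measure lebesgue (\<Union>i\<in>D. I i) \<le> e * (\<Sum>i\<in>D. measure lebesgue (I i))"
      using \<open>0 < e\<close> D by (intro mult_left_mono measure_UNION_le) (auto simp: I_def)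
    also have "\<dots> = (\<Sum>i\<in>D. e * \<bar>snd i - fst i\<bar>)" by (simp add: meas sum_distrib_left)
    also have "\<dots> \<le> (\<Sum>i\<in>D. norm (measure lborel (I i) *\<^sub>R f (fst i) - integral (I i) f))"
    proof (rule sum_mono)
      fix i assume "i \<in> D"
      then have "i \<in> K" using D C by auto
      obtain x y where i: "i = (x, y)" by force
      have K: "I i \<subseteq> {a..b}" "e * \<bar>y - x\<bar> < norm (F y - F x - (y - x) *\<^sub>R f x)"
        using \<open>i \<in> K\<close> i by (auto simp: K_def)
      have "norm (measure lborel (I i) *\<^sub>R f (fst i) - integral (I i) f) = norm (F y - F x - (y - x) *\<^sub>R f x)"
      proof (cases "x \<le> y")
        case True
        then have "F y - F x = integral {x..y} f" using K i by (intro F) (auto simp: I_def)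
        then show ?thesis using True i by (simp add: I_def norm_minus_commute)
      next
        case False
        then have "F x - F y = integral {y..x} f" using K i by (intro F) (auto simp: I_def)
        then have "measure lborel (I i) *\<^sub>R f (fst i) - integral (I i) f = F y - F x - (y - x) *\<^sub>R f x"
          using False i by (simp add: I_def algebra_simps)
        then show ?thesis by simp
      qed
      with K i show "e * \<bar>snd i - fst i\<bar> \<le> norm (measure lborel (I i) *\<^sub>R f (fst i) - integral (I i) f)"
        by simp
    qed
    also have "\<dots> = sum (\<lambda>(x,k). norm (measure lborel k *\<^sub>R f x - integral k f)) p"
      unfolding p_def by (subst sum.reindex[OF inj]) (simp add: o_def)
    also have "\<dots> < e * \<eta>" using \<gamma>[OF p fine] .
    finally show ?thesis using \<open>0 < e\<close> by simp
  qed
  let ?U = "\<Union>i\<in>C. I i" and ?N = "?E - (\<Union>i\<in>C. cball (c i) (r i))"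
  have lm: "I i \<in> lmeasurable" for i by (auto simp: I_def split: prod.split)
  have U: "?U \<in> lmeasurable" "measure lebesgue ?U \<le> \<eta>"
    using fmeasurable_UN_bound[OF C(1) lm small] measure_UN_bound[OF C(1) lm small] by auto
  have N: "?N \<in> lmeasurable" "measure lebesgue ?N = 0"
    using C(4) by (auto intro: negligible_imp_measurable negligible_imp_measure0)
  show "\<exists>T. ?E \<subseteq> T \<and> T \<in> lmeasurable \<and> measure lebesgue T \<le> \<eta>"
  proof (intro exI[of _ "?N \<union> ?U"] conjI)
    show "?E \<subseteq> ?N \<union> ?U" unfolding I by blast
    show "?N \<union> ?U \<in> lmeasurable" using N U by auto
    show "measure lebesgue (?N \<union> ?U) \<le> \<eta>"
      using measure_Un_le[of ?N lebesgue ?U] N U by (auto simp: fmeasurableD)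
  qed
qed

text \<open>Where the derivative is not \<open>f x\<close>, some tolerance
  \<open>1 / real (Suc n)\<close> is violated arbitrarily close to \<open>x\<close>. Countably many
  tolerances and windows \<open>{-real k<..<real k}\<close> exhaust these points, and each pair
  contributes a negligible set.\<close>

lemma AE_has_vector_derivative_indefinite_integral:
  fixes f F :: "real \<Rightarrow> 'a::euclidean_space"
  assumes f: "\<And>x y. x \<le> y \<Longrightarrow> (f has_integral (F y - F x)) {x..y}"
  shows "AE x in lebesgue. (F has_vector_derivative f x) (at x)"
proof -
  define E where "E = (\<lambda>n k. {x \<in> {-real k<..<real k}. \<forall>d>0. \<exists>y. y \<noteq> x \<and> \<bar>y - x\<bar> < d \<and>
           (1 / real (Suc n)) * \<bar>y - x\<bar> < norm (F y - F x - (y - x) *\<^sub>R f x)})"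
  have "negligible (E n k)" for n k
  proof -
    have "f integrable_on {- real k..real k}" using f[of "- real k" "real k"] by auto
    then show ?thesis unfolding E_def
      by (rule negligible_violating_points) (use integral_unique[OF f] in auto)
  qed
  then have "negligible (\<Union>n. \<Union>k. E n k)"
    by (intro negligible_countable_Union) auto
  then have "AE x in lebesgue. x \<notin> (\<Union>n. \<Union>k. E n k)"
    unfolding negligible_iff_null_sets by (rule AE_not_in)
  then show ?thesis
  proof eventually_elim
    case (elim x)
    obtain k where k: "\<bar>x\<bar> < real k" using reals_Archimedean2 by blast
    show ?case unfolding has_vector_derivative_def has_derivative_at_alt
    proof (intro conjI allI impI)
      show "bounded_linear (\<lambda>h. h *\<^sub>R f x)" by (rule bounded_linear_scaleR_left)
      fix e :: real assume "0 < e"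
      then obtain n where n: "1 / real (Suc n) < e" using nat_approx_posE by blast
      have "x \<notin> E n k" "x \<in> {-real k<..<real k}" using elim k by auto
      then obtain d where d: "d > 0" "\<And>y. \<lbrakk>y \<noteq> x; \<bar>y - x\<bar> < d\<rbrakk> \<Longrightarrow>
          norm (F y - F x - (y - x) *\<^sub>R f x) \<le> (1 / real (Suc n)) * \<bar>y - x\<bar>"
        unfolding E_def mem_Collect_eq not_less[symmetric] by blast
      show "\<exists>d>0. \<forall>y. norm (y - x) < d \<longrightarrow> norm (F y - F x - (y - x) *\<^sub>R f x) \<le> e * norm (y - x)"
      proof (intro exI[of _ d] conjI allI impI)
        fix y assume y: "norm (y - x) < d"
        show "norm (F y - F x - (y - x) *\<^sub>R f x) \<le> e * norm (y - x)"
        proof (cases "y = x")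
          case False
          with d(2)[of y] y have "norm (F y - F x - (y - x) *\<^sub>R f x) \<le> (1 / real (Suc n)) * \<bar>y - x\<bar>" by simp
          also have "\<dots> \<le> e * \<bar>y - x\<bar>" using n by (intro mult_right_mono) auto
          finally show ?thesis by simp
        qed simp
      qed fact
    qed
  qed
qed

subsection \<open>Indefinite integrals of complex functions\<close>

text \<open>Lebesgue rather than gauge integrability of \<open>g\<close> is what yields absolute
  continuity of \<open>f\<close>, and Borel measurability opens the way to Fubini's theorem. The
  integrand is an explicit argument, so that it can be differentiated again whenever it is itself a
  primitive.\<close>

definition is_primitive :: "(real \<Rightarrow> complex) \<Rightarrow> (real \<Rightarrow> complex) \<Rightarrow> bool" where
  "is_primitive f g \<longleftrightarrow> g \<in> borel_measurable borel \<and>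
     (\<forall>x y. x \<le> y \<longrightarrow> set_integrable lborel {x..y} g \<and> f y - f x = (LINT t:{x..y}|lborel. g t))"

lemma is_primitiveD:
  assumes "is_primitive f g"
  shows "g \<in> borel_measurable borel"
    and "x \<le> y \<Longrightarrow> set_integrable lborel {x..y} g"
    and "x \<le> y \<Longrightarrow> f y - f x = (LINT t:{x..y}|lborel. g t)"
  using assms by (auto simp: is_primitive_def)

lemma is_primitive_has_integral:
  assumes "is_primitive f g" "x \<le> y"
  shows "(g has_integral (f y - f x)) {x..y}"
  using set_borel_integral_eq_integral[OF is_primitiveD(2)[OF assms]] is_primitiveD(3)[OF assms]
  by (simp add: has_integral_iff)

lemma is_primitive_AE_has_vector_derivative:
  assumes "is_primitive f g"
  shows "AE x in lebesgue. (f has_vector_derivative g x) (at x)"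
  using is_primitive_has_integral[OF assms] by (rule AE_has_vector_derivative_indefinite_integral)

lemma is_primitive_eq_integral:
  assumes "is_primitive f g" "a \<le> x"
  shows "f x = f a + integral {a..x} g"
  using is_primitive_has_integral[OF assms] by (simp add: has_integral_iff)

lemma is_primitive_continuous:
  assumes "is_primitive f g"
  shows "continuous_on UNIV f"
proof -
  have "isCont f x" for x
  proof -
    have "g integrable_on {x - 1..x + 1}"
      using is_primitive_has_integral[OF assms, of "x - 1" "x + 1"] by auto
    then have "continuous_on {x - 1..x + 1} (\<lambda>u. f (x - 1) + integral {x - 1..u} g)"
      by (intro continuous_intros indefinite_integral_continuous_1)
    then have "continuous_on {x - 1..x + 1} f"
      by (rule continuous_on_eq) (auto simp: is_primitive_eq_integral[OF assms, symmetric])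
    then show "isCont f x" by (rule continuous_on_interior) auto
  qed
  then show ?thesis by (simp add: continuous_at_imp_continuous_on)
qed

lemma is_primitive_has_vector_derivative:
  assumes "is_primitive f g" "continuous_on UNIV g"
  shows "(f has_vector_derivative g x) (at x)"
proof -
  have "((\<lambda>u. integral {x - 1..u} g) has_vector_derivative g x) (at x within {x - 1..x + 1})"
    by (rule integral_has_vector_derivative) (use assms(2) continuous_on_subset in auto)
  then have "((\<lambda>u. f (x - 1) + integral {x - 1..u} g) has_vector_derivative g x)
      (at x within {x - 1..x + 1})"
    by (auto intro!: derivative_eq_intros)
  then have "((\<lambda>u. f (x - 1) + integral {x - 1..u} g) has_vector_derivative g x) (at x)"
    by (simp add: at_within_Icc_at)
  then show ?thesis
    by (rule has_vector_derivative_transform_within_open[where S = "{x - 1<..<x + 1}"])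
      (auto simp: is_primitive_eq_integral[OF assms(1), symmetric])
qed

text \<open>On the intervals, the part of \<open>norm (g t)\<close> below \<open>M\<close>
  contributes at most \<open>M\<close> times the total length, and the rest \<open>B\<close>
  contributes at most \<open>\<epsilon> / 2\<close> altogether because the intervals are disjoint.
  Hence \<open>\<delta> = \<epsilon> / (2 * M)\<close>.\<close>

lemma is_primitive_locally_abs_continuous:
  assumes prim: "is_primitive f g"
  shows "locally_abs_continuous f"
  unfolding locally_abs_continuous_def abs_continuous_on_Icc_def
proof (intro allI impI)
  fix c d \<epsilon> :: real assume "c \<le> d" "0 < \<epsilon>"
  note [measurable] = is_primitiveD(1)[OF prim]
  define G where "G = (\<lambda>t. indicator {c..d} t *\<^sub>R norm (g t))"
  have G: "integrable lborel G"
    using integrable_norm[OF is_primitiveD(2)[OF prim \<open>c \<le> d\<close>, unfolded set_integrable_def]]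
    by (simp add: G_def)
  obtain M where "0 < M"
      and M: "(LINT t|lborel. indicator {t. M < \<bar>G t\<bar> \<or> M < \<bar>t\<bar>} t * \<bar>G t\<bar>) \<le> \<epsilon> / 2"
    using integrable_small_truncation[OF G, of "\<epsilon> / 2"] \<open>0 < \<epsilon>\<close> by auto
  define B where "B = (\<lambda>t. indicator {t. M < \<bar>G t\<bar> \<or> M < \<bar>t\<bar>} t * \<bar>G t\<bar>)"
  have [measurable]: "G \<in> borel_measurable borel" "B \<in> borel_measurable borel"
    unfolding B_def G_def by measurable
  have B: "integrable lborel B"
    by (rule Bochner_Integration.integrable_bound[OF G]) (auto simp: B_def split: split_indicator)
  have B0: "0 \<le> B t" for t by (simp add: B_def)
  show "\<exists>\<delta>>0. \<forall>(n::nat) (l::nat \<Rightarrow> real) (r::nat \<Rightarrow> real).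
        (\<forall>i<n. c \<le> l i \<and> l i \<le> r i \<and> r i \<le> d) \<and>
        disjoint_family_on (\<lambda>i. {l i<..<r i}) {..<n} \<and>
        (\<Sum>i<n. r i - l i) < \<delta>
        \<longrightarrow> (\<Sum>i<n. norm (f (r i) - f (l i))) < \<epsilon>"
  proof (intro exI[of _ "\<epsilon> / (2 * M)"] conjI allI impI)
    show "0 < \<epsilon> / (2 * M)" using \<open>0 < \<epsilon>\<close> \<open>0 < M\<close> by simp
    fix n :: nat and l r :: "nat \<Rightarrow> real"
    assume "(\<forall>i<n. c \<le> l i \<and> l i \<le> r i \<and> r i \<le> d) \<and>
        disjoint_family_on (\<lambda>i. {l i<..<r i}) {..<n} \<and> (\<Sum>i<n. r i - l i) < \<epsilon> / (2 * M)"
    then have lr: "\<And>i. i < n \<Longrightarrow> c \<le> l i \<and> l i \<le> r i \<and> r i \<le> d"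
      and disj: "disjoint_family_on (\<lambda>i. {l i<..<r i}) {..<n}"
      and small: "(\<Sum>i<n. r i - l i) < \<epsilon> / (2 * M)" by auto
    let ?J = "\<lambda>i. {l i<..<r i}"
    have J: "integrable lborel (\<lambda>t. indicator (?J i) t * B t)" for i
      using integrable_mult_indicator[OF _ B, of "?J i"] by simp
    have one: "norm (f (r i) - f (l i)) \<le> M * (r i - l i) + (LINT t|lborel. indicator (?J i) t * B t)"
      if "i < n" for i
    proof -
      have le: "l i \<le> r i" using lr that by simp
      have int: "integrable lborel (\<lambda>t. indicator {l i..r i} t *\<^sub>R norm (g t))"
        using integrable_norm[OF is_primitiveD(2)[OF prim le, unfolded set_integrable_def]] by simp
      have "norm (f (r i) - f (l i)) \<le> (LINT t|lborel. norm (indicator {l i..r i} t *\<^sub>R g t))"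
        unfolding is_primitiveD(3)[OF prim le] set_lebesgue_integral_def
        by (rule integral_norm_bound)
      also have "\<dots> = (LINT t|lborel. indicator {l i..r i} t *\<^sub>R norm (g t))" by simp
      also have "\<dots> \<le> (LINT t|lborel. M * indicator (?J i) t + indicator (?J i) t * B t)"
      proof (rule integral_mono_AE[OF int])
        show "integrable lborel (\<lambda>t. M * indicator (?J i) t + indicator (?J i) t * B t)"
          using J le
          by (intro Bochner_Integration.integrable_add integrable_mult_right integrable_real_indicator) auto
        \<comment> \<open>Disjointness is known for the open intervals only, so the two end points
          are discarded as null sets.\<close>
        show "AE t in lborel. indicator {l i..r i} t *\<^sub>R norm (g t)
            \<le> M * indicator (?J i) t + indicator (?J i) t * B t"
          using AE_lborel_singleton[of "l i"] AE_lborel_singleton[of "r i"]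
        proof eventually_elim
          case (elim t)
          then show ?case using lr[OF that] B0[of t] \<open>0 < M\<close>
            by (auto simp: B_def G_def not_less split: split_indicator)
        qed
      qed
      also have "\<dots> = M * (r i - l i) + (LINT t|lborel. indicator (?J i) t * B t)"
        using J le by (subst Bochner_Integration.integral_add) auto
      finally show ?thesis .
    qed
    have "(\<Sum>i<n. norm (f (r i) - f (l i)))
        \<le> (\<Sum>i<n. M * (r i - l i) + (LINT t|lborel. indicator (?J i) t * B t))"
      using one by (intro sum_mono) auto
    also have "\<dots> = M * (\<Sum>i<n. r i - l i) + (\<Sum>i<n. (LINT t|lborel. indicator (?J i) t * B t))"
      by (simp add: sum.distrib sum_distrib_left)
    also have "(\<Sum>i<n. (LINT t|lborel. indicator (?J i) t * B t))
        = (LINT t|lborel. (\<Sum>i<n. indicator (?J i) t * B t))"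
      using J by (subst Bochner_Integration.integral_sum) auto
    also have "\<dots> \<le> (LINT t|lborel. B t)"
    proof (rule integral_mono)
      show "integrable lborel (\<lambda>t. \<Sum>i<n. indicator (?J i) t * B t)"
        using J by (intro Bochner_Integration.integrable_sum) auto
      fix t
      have "(\<Sum>i<n. indicator (?J i) t * B t) = indicator (\<Union>i<n. ?J i) t * B t"
        unfolding indicator_UN_disjoint[OF finite_lessThan disj] by (simp add: sum_distrib_right)
      also have "\<dots> \<le> B t" using B0 by (auto split: split_indicator)
      finally show "(\<Sum>i<n. indicator (?J i) t * B t) \<le> B t" .
    qed (rule B)
    also have "\<dots> \<le> \<epsilon> / 2" using M by (simp add: B_def)
    also have "M * (\<Sum>i<n. r i - l i) < M * (\<epsilon> / (2 * M))"
      using small \<open>0 < M\<close> by (rule mult_strict_left_mono)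
    also have "M * (\<epsilon> / (2 * M)) + \<epsilon> / 2 = \<epsilon>" using \<open>0 < M\<close> by simp
    finally show "(\<Sum>i<n. norm (f (r i) - f (l i))) < \<epsilon>" by simp
  qed
qed

lemma is_primitive_add:
  assumes f: "is_primitive f g" and F: "is_primitive F G"
  shows "is_primitive (\<lambda>x. f x + F x) (\<lambda>x. g x + G x)"
  unfolding is_primitive_def
proof (intro conjI allI impI)
  note [measurable] = is_primitiveD(1)[OF f] is_primitiveD(1)[OF F]
  show "(\<lambda>x. g x + G x) \<in> borel_measurable borel" by measurable
  fix x y :: real assume xy: "x \<le> y"
  show "set_integrable lborel {x..y} (\<lambda>x. g x + G x)"
    using is_primitiveD(2)[OF f xy] is_primitiveD(2)[OF F xy] by simp
  show "f y + F y - (f x + F x) = (LINT t:{x..y}|lborel. g t + G t)"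
    using is_primitiveD(2)[OF f xy] is_primitiveD(2)[OF F xy]
    by (simp add: set_integral_add(2) flip: is_primitiveD(3)[OF f xy] is_primitiveD(3)[OF F xy])
qed

lemma is_primitive_cmult:
  assumes f: "is_primitive f g"
  shows "is_primitive (\<lambda>x. \<alpha> * f x) (\<lambda>x. \<alpha> * g x)"
  unfolding is_primitive_def
proof (intro conjI allI impI)
  note [measurable] = is_primitiveD(1)[OF f]
  show "(\<lambda>x. \<alpha> * g x) \<in> borel_measurable borel" by measurable
  fix x y :: real assume xy: "x \<le> y"
  show "set_integrable lborel {x..y} (\<lambda>x. \<alpha> * g x)"
    using is_primitiveD(2)[OF f xy] by simp
  show "\<alpha> * f y - \<alpha> * f x = (LINT t:{x..y}|lborel. \<alpha> * g t)"
    by (simp add: right_diff_distrib flip: is_primitiveD(3)[OF f xy])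
qed

lemma integrable_pair_mult:
  fixes f g :: "real \<Rightarrow> complex"
  assumes f: "integrable lborel f" and g: "integrable lborel g"
  shows "integrable (lborel \<Otimes>\<^sub>M lborel) (\<lambda>(s, t). f s * g t)"
proof (rule lborel_pair.Fubini_integrable)
  have [measurable]: "f \<in> borel_measurable borel" "g \<in> borel_measurable borel"
    using borel_measurable_integrable[OF f] borel_measurable_integrable[OF g] by simp_all
  show "(\<lambda>(s, t). f s * g t) \<in> borel_measurable (lborel \<Otimes>\<^sub>M lborel)" by measurable
  show "integrable lborel (\<lambda>s. LINT t|lborel. norm (case (s, t) of (s, t) \<Rightarrow> f s * g t))"
    using f by (simp add: norm_mult)
  show "AE s in lborel. integrable lborel (\<lambda>t. case (s, t) of (s, t) \<Rightarrow> f s * g t)"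
    using g by simp
qed

text \<open>The product rule in integrated form. Fubini's theorem for
  \<open>\<alpha> * exp (\<alpha> * s) * g t\<close> on the triangle
  \<open>x \<le> t \<le> s \<le> y\<close> produces \<open>f s - f x\<close> when \<open>t\<close>
  is integrated first and a difference of exponentials when \<open>s\<close> is integrated
  first.\<close>

lemma is_primitive_exp_mult:
  assumes f: "is_primitive f g"
  shows "is_primitive (\<lambda>x. exp (\<alpha> * of_real x) * f x)
           (\<lambda>x. \<alpha> * (exp (\<alpha> * of_real x) * f x) + exp (\<alpha> * of_real x) * g x)"
  unfolding is_primitive_def
proof (intro conjI allI impI)
  note [measurable] = is_primitiveD(1)[OF f]
  note cont = is_primitive_continuous[OF f]
  have [measurable]: "f \<in> borel_measurable borel"
    using cont by (rule borel_measurable_continuous_onI)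
  let ?E = "\<lambda>x::real. exp (\<alpha> * of_real x)"
  show "(\<lambda>x. \<alpha> * (?E x * f x) + ?E x * g x) \<in> borel_measurable borel" by measurable
  fix x y :: real assume xy: "x \<le> y"
  have "continuous_on {x..y} f" using cont by (rule continuous_on_subset) simp
  then have int1: "set_integrable lborel {x..y} (\<lambda>x. \<alpha> * (?E x * f x))"
    by (intro borel_integrable_atLeastAtMost' continuous_intros)
  have intE: "set_integrable lborel {x..y} (\<lambda>s. \<alpha> * ?E s)"
    by (rule borel_integrable_atLeastAtMost') (intro continuous_intros)
  have int2: "set_integrable lborel {x..y} (\<lambda>x. ?E x * g x)"
  proof -
    have "compact (?E ` {x..y})"
      by (intro compact_continuous_image continuous_intros) auto
    then have "bounded (?E ` {x..y})" by (rule compact_imp_bounded)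
    then obtain b where b: "\<And>t. t \<in> {x..y} \<Longrightarrow> norm (?E t) \<le> b"
      unfolding bounded_iff by blast
    show ?thesis
    proof (rule set_integrable_bound)
      show "set_integrable lborel {x..y} (\<lambda>t. of_real b * g t)"
        using is_primitiveD(2)[OF f xy] by simp
      show "set_borel_measurable lborel {x..y} (\<lambda>t. ?E t * g t)"
        unfolding set_borel_measurable_def by measurable
      show "AE t in lborel. t \<in> {x..y} \<longrightarrow> norm (?E t * g t) \<le> norm (of_real b * g t)"
      proof (intro AE_I2 impI)
        fix t assume "t \<in> {x..y}"
        then have "norm (?E t) \<le> b" by (rule b)
        then have "norm (?E t) \<le> \<bar>b\<bar>" by linarith
        then show "norm (?E t * g t) \<le> norm (of_real b * g t)"
          by (simp add: norm_mult mult_right_mono)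
      qed
    qed
  qed
  show "set_integrable lborel {x..y} (\<lambda>x. \<alpha> * (?E x * f x) + ?E x * g x)"
    using int1 int2 by simp
  define \<Phi> where "\<Phi> = (\<lambda>s t. (if t \<le> s then 1 else 0) *
    ((indicator {x..y} s *\<^sub>R (\<alpha> * ?E s)) * (indicator {x..y} t *\<^sub>R g t)))"
  have "integrable (lborel \<Otimes>\<^sub>M lborel) (case_prod \<Phi>)"
  proof (rule Bochner_Integration.integrable_bound)
    show "integrable (lborel \<Otimes>\<^sub>M lborel)
        (\<lambda>(s, t). (indicator {x..y} s *\<^sub>R (\<alpha> * ?E s)) * (indicator {x..y} t *\<^sub>R g t))"
      using intE is_primitiveD(2)[OF f xy] unfolding set_integrable_def
      by (rule integrable_pair_mult)
    show "case_prod \<Phi> \<in> borel_measurable (lborel \<Otimes>\<^sub>M lborel)"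
      unfolding \<Phi>_def by measurable
  qed (auto simp: \<Phi>_def)
  then have Fub: "(LINT t|lborel. LINT s|lborel. \<Phi> s t) = (LINT s|lborel. LINT t|lborel. \<Phi> s t)"
    by (rule lborel_pair.Fubini_integral)
  have inner1: "(LINT t|lborel. \<Phi> s t) = indicator {x..y} s *\<^sub>R (\<alpha> * ?E s * (f s - f x))" for s
  proof (cases "s \<in> {x..y}")
    case True
    then have s: "x \<le> s" by simp
    have "\<Phi> s t = \<alpha> * ?E s * (indicator {x..s} t *\<^sub>R g t)" for t
      using True by (auto simp: \<Phi>_def split: split_indicator)
    then have "(LINT t|lborel. \<Phi> s t) = \<alpha> * ?E s * (f s - f x)"
      unfolding is_primitiveD(3)[OF f s] set_lebesgue_integral_def by (simp del: mult_scaleR_right)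
    then show ?thesis using True by simp
  qed (simp add: \<Phi>_def)
  have inner2: "(LINT s|lborel. \<Phi> s t) = indicator {x..y} t *\<^sub>R ((?E y - ?E t) * g t)" for t
  proof (cases "t \<in> {x..y}")
    case True
    then have t: "t \<le> y" by simp
    have FTC: "(LINT s|lborel. indicator {t..y} s *\<^sub>R (\<alpha> * ?E s)) = ?E y - ?E t"
    proof (rule integral_FTC_Icc[OF t])
      fix s
      have "((\<lambda>u. exp (\<alpha> * u)) has_field_derivative \<alpha> * exp (\<alpha> * of_real s)) (at (of_real s))"
        by (auto intro!: derivative_eq_intros)
      from has_vector_derivative_real_field[OF this]
      show "(?E has_vector_derivative \<alpha> * ?E s) (at s within {t..y})" .
    qed (intro continuous_intros)
    have "\<Phi> s t = (indicator {t..y} s *\<^sub>R (\<alpha> * ?E s)) * g t" for s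
      using True by (auto simp: \<Phi>_def split: split_indicator)
    then show ?thesis using True by (simp add: FTC del: mult_scaleR_left)
  qed (simp add: \<Phi>_def)
  have "(LINT t:{x..y}|lborel. (?E y - ?E t) * g t)
      = (LINT t:{x..y}|lborel. ?E y * g t - ?E t * g t)"
    by (simp add: left_diff_distrib)
  also have "\<dots> = ?E y * (f y - f x) - (LINT t:{x..y}|lborel. ?E t * g t)"
    using int2 is_primitiveD(2)[OF f xy] by (simp add: is_primitiveD(3)[OF f xy])
  finally have R: "(LINT t:{x..y}|lborel. (?E y - ?E t) * g t)
      = ?E y * (f y - f x) - (LINT t:{x..y}|lborel. ?E t * g t)" .
  have FTC: "(LINT s:{x..y}|lborel. \<alpha> * ?E s) = ?E y - ?E x"
    unfolding set_lebesgue_integral_def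
  proof (rule integral_FTC_Icc[OF xy])
    fix s
    have "((\<lambda>u. exp (\<alpha> * u)) has_field_derivative \<alpha> * exp (\<alpha> * of_real s)) (at (of_real s))"
      by (auto intro!: derivative_eq_intros)
    from has_vector_derivative_real_field[OF this]
    show "(?E has_vector_derivative \<alpha> * ?E s) (at s within {x..y})" .
  qed (intro continuous_intros)
  have "(LINT s:{x..y}|lborel. \<alpha> * ?E s * (f s - f x))
      = (LINT s:{x..y}|lborel. \<alpha> * (?E s * f s) - f x * (\<alpha> * ?E s))"
    by (simp add: algebra_simps)
  also have "\<dots> = (LINT s:{x..y}|lborel. \<alpha> * (?E s * f s)) - f x * (?E y - ?E x)"
    using int1 intE FTC by (subst set_integral_diff(2)) simp_all
  finally have L: "(LINT s:{x..y}|lborel. \<alpha> * ?E s * (f s - f x))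
      = (LINT s:{x..y}|lborel. \<alpha> * (?E s * f s)) - f x * (?E y - ?E x)" .
  have "(LINT s:{x..y}|lborel. \<alpha> * (?E s * f s)) - f x * (?E y - ?E x)
      = ?E y * (f y - f x) - (LINT t:{x..y}|lborel. ?E t * g t)"
    using Fub unfolding inner1 inner2 by (simp add: L R flip: set_lebesgue_integral_def)
  then show "?E y * f y - ?E x * f x = (LINT t:{x..y}|lborel. \<alpha> * (?E t * f t) + ?E t * g t)"
    using int1 int2 by (simp add: set_integral_add(2) algebra_simps)
qed

subsection \<open>Volterra operators on left half-lines\<close>

lemma set_integral_dominated:
  fixes f :: "real \<Rightarrow> complex"
  assumes f: "f \<in> borel_measurable borel" and A: "A \<in> sets borel"
    and g: "set_integrable lborel A g" and le: "\<And>t. t \<in> A \<Longrightarrow> norm (f t) \<le> g t"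
  shows "set_integrable lborel A f" "norm (LINT t:A|lborel. f t) \<le> (LINT t:A|lborel. g t)"
proof -
  note [measurable] = f A
  have le': "norm (f t) \<le> \<bar>g t\<bar>" if "t \<in> A" for t
    using le[OF that] by linarith
  show f': "set_integrable lborel A f"
    unfolding set_integrable_def
    by (rule Bochner_Integration.integrable_bound[OF g[unfolded set_integrable_def]])
      (use le' in \<open>auto split: split_indicator\<close>)
  show "norm (LINT t:A|lborel. f t) \<le> (LINT t:A|lborel. g t)"
    unfolding set_lebesgue_integral_def
    by (rule Bochner_Integration.integral_norm_bound_integral[OF f'[unfolded set_integrable_def] g[unfolded set_integrable_def]])
      (use le in \<open>auto split: split_indicator\<close>)
qed

section \<open>A weight that makes one integration gain an arbitrarily small factor\<close>

lemma exp_weight_antiderivative: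
  fixes L M \<tau> x :: real
  assumes "0 < L" "0 < M" "\<tau> \<le> x"
  shows "set_integrable lborel {\<tau>..x} (\<lambda>s. M * exp (- L * s))"
    and "(LINT s:{\<tau>..x}|lborel. M * exp (- L * s)) \<le> M / L * exp (- L * \<tau>)"
proof -
  show "set_integrable lborel {\<tau>..x} (\<lambda>s. M * exp (- L * s))"
    by (intro borel_integrable_atLeastAtMost' continuous_intros)
  have "(LINT s:{\<tau>..x}|lborel. M * exp (- L * s)) = - (M / L) * exp (- L * x) - (- (M / L) * exp (- L * \<tau>))"
    unfolding set_lebesgue_integral_def
  proof (rule integral_FTC_Icc)
    fix s
    have "((\<lambda>s. - (M / L) * exp (- L * s)) has_real_derivative M * exp (- L * s)) (at s within {\<tau>..x})"
      using assms by (auto intro!: derivative_eq_intros)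
    then show "((\<lambda>s. - (M / L) * exp (- L * s)) has_vector_derivative M * exp (- L * s)) (at s within {\<tau>..x})"
      by (simp add: has_real_derivative_iff_has_vector_derivative)
  qed (use assms in \<open>auto intro!: continuous_intros\<close>)
  also have "\<dots> \<le> M / L * exp (- L * \<tau>)" using assms by simp
  finally show "(LINT s:{\<tau>..x}|lborel. M * exp (- L * s)) \<le> M / L * exp (- L * \<tau>)" .
qed

text \<open>The weight is constant on \<open>{..-M}\<close> and decays exponentially on \<open>{-M..}\<close>, where \<open>M\<close> is such
  that the part of \<open>p\<close> above height \<open>M\<close> or outside \<open>{-M..M}\<close> has integral at most \<open>e / 2\<close>. Being
  bounded and bounded away from \<open>0\<close> on \<open>{..X}\<close>, it turns into geometric bounds with arbitrarily small
  ratio \<open>e\<close> for the iterated kernels, which replace the usual factorial bounds.\<close>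

lemma decreasing_weight:
  fixes p :: "real \<Rightarrow> real"
  assumes p: "set_integrable lborel {..X} p" "p \<in> borel_measurable borel" and p0: "\<And>t. 0 \<le> p t" and "0 < e"
  obtains \<psi> B where "\<And>t. 0 < \<psi> t" "\<And>s t. s \<le> t \<Longrightarrow> \<psi> t \<le> \<psi> s" "\<And>t. \<psi> t \<le> B"
    "\<And>t x. \<lbrakk>t \<le> x; x \<le> X\<rbrakk> \<Longrightarrow> set_integrable lborel {t..x} (\<lambda>s. p s * \<psi> s)"
    "\<And>t x. \<lbrakk>t \<le> x; x \<le> X\<rbrakk> \<Longrightarrow> (LINT s:{t..x}|lborel. p s * \<psi> s) \<le> e * \<psi> t"
proof -
  define g where "g = (\<lambda>t. indicator {..X} t * p t)"
  have g: "integrable lborel g" using p(1) by (simp add: g_def set_integrable_def)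
  obtain M where "0 < M"
      and M: "(LINT t|lborel. indicator {t. M < \<bar>g t\<bar> \<or> M < \<bar>t\<bar>} t * \<bar>g t\<bar>) \<le> e / 2"
    using integrable_small_truncation[OF g, of "e / 2"] \<open>0 < e\<close> by auto
  define b where "b = (\<lambda>t. indicator {t. M < \<bar>g t\<bar> \<or> M < \<bar>t\<bar>} t * \<bar>g t\<bar>)"
  \<comment> \<open>Chosen so that \<open>M / L = e / 2\<close>: the bounded part of
    \<open>p\<close> then costs half of the allowed \<open>e * \<psi> t\<close>, and the remainder
    \<open>b\<close> the other half.\<close>
  define L where "L = 2 * M / e"
  define \<psi> where "\<psi> = (\<lambda>t. exp (- L * max t (- M)))"
  have "0 < L" using \<open>0 < M\<close> \<open>0 < e\<close> by (simp add: L_def)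
  note [measurable] = p(2)
  have [measurable]: "g \<in> borel_measurable borel" unfolding g_def by measurable
  have [measurable]: "b \<in> borel_measurable borel" "\<psi> \<in> borel_measurable borel"
    unfolding b_def \<psi>_def by measurable
  have b: "integrable lborel b"
    by (rule Bochner_Integration.integrable_bound[OF g]) (auto simp: b_def split: split_indicator)
  have b0: "0 \<le> b t" for t by (simp add: b_def)
  have anti: "\<psi> t \<le> \<psi> s" if "s \<le> t" for s t
    using that \<open>0 < L\<close> by (simp add: \<psi>_def max_def)
  have pos: "0 < \<psi> t" for t by (simp add: \<psi>_def)
  have bnd: "\<psi> t \<le> exp (L * M)" for t
    using mult_left_mono[of "- M" "max t (- M)" L] \<open>0 < L\<close> by (simp add: \<psi>_def)
  have int: "set_integrable lborel {t..x} (\<lambda>s. p s * \<psi> s)" if "t \<le> x" "x \<le> X" for t x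
  proof (rule set_integrable_bound)
    show "set_integrable lborel {t..x} (\<lambda>s. exp (L * M) * p s)"
      using that by (intro set_integrable_mult_right set_integrable_subset[OF p(1)]) auto
    show "set_borel_measurable lborel {t..x} (\<lambda>s. p s * \<psi> s)"
      unfolding set_borel_measurable_def by measurable
    show "AE s in lborel. s \<in> {t..x} \<longrightarrow> norm (p s * \<psi> s) \<le> norm (exp (L * M) * p s)"
    proof (intro AE_I2 impI)
      fix s
      show "norm (p s * \<psi> s) \<le> norm (exp (L * M) * p s)"
        using mult_right_mono[OF bnd[of s] p0[of s]] p0[of s] pos[of s]
        by (simp add: abs_mult mult.commute)
    qed
  qed
  have le: "(LINT s:{t..x}|lborel. p s * \<psi> s) \<le> e * \<psi> t" if "t \<le> x" "x \<le> X" for t x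
  proof -
    \<comment> \<open>By definition \<open>\<psi> t = exp (- L * \<tau>)\<close>. If
      \<open>x\<close> lies left of \<open>-M\<close>, there is no exponential part, and the maximum
      in \<open>y\<close> lets \<open>{\<tau>..y}\<close> shrink to a point.\<close>
    define \<tau> where "\<tau> = max t (- M)"
    define y where "y = max \<tau> x"
    have "\<tau> \<le> y" by (simp add: y_def)
    note E = exp_weight_antiderivative[OF \<open>0 < L\<close> \<open>0 < M\<close> \<open>\<tau> \<le> y\<close>]
    have "(LINT s:{t..x}|lborel. p s * \<psi> s)
        \<le> (LINT s|lborel. \<psi> t * b s + indicator {\<tau>..y} s *\<^sub>R (M * exp (- L * s)))"
      unfolding set_lebesgue_integral_def
    proof (rule integral_mono)
      show "integrable lborel (\<lambda>s. indicator {t..x} s *\<^sub>R (p s * \<psi> s))"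
        using int[OF that] by (simp add: set_integrable_def)
      show "integrable lborel (\<lambda>s. \<psi> t * b s + indicator {\<tau>..y} s *\<^sub>R (M * exp (- L * s)))"
        using b E(1) unfolding set_integrable_def by (intro Bochner_Integration.integrable_add integrable_mult_right) auto
      fix s
      show "indicator {t..x} s *\<^sub>R (p s * \<psi> s) \<le> \<psi> t * b s + indicator {\<tau>..y} s *\<^sub>R (M * exp (- L * s))"
      proof (cases "s \<in> {t..x}")
        case True
        then have gs: "g s = p s" using that by (simp add: g_def)
        have "p s * \<psi> s \<le> \<psi> t * b s + indicator {\<tau>..y} s *\<^sub>R (M * exp (- L * s))"
        \<comment> \<open>At the exceptional points monotonicity replaces \<open>\<psi> s\<close> by
          \<open>\<psi> t\<close>, which leaves the small integral of \<open>b\<close>. Elsewhere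
          \<open>p s \<le> M\<close> and \<open>\<psi> s\<close> is the plain exponential, which
          integrates explicitly.\<close>
        proof (cases "M < \<bar>g s\<bar> \<or> M < \<bar>s\<bar>")
          case bad: True
          have "p s * \<psi> s \<le> \<psi> t * p s" using mult_right_mono[OF anti[of t s] p0[of s]] True by (simp add: mult.commute)
          also have "\<dots> = \<psi> t * b s" using bad gs p0[of s] by (simp add: b_def)
          also have "\<dots> \<le> \<dots> + indicator {\<tau>..y} s *\<^sub>R (M * exp (- L * s))"
            using \<open>0 < M\<close> by simp
          finally show ?thesis .
        next
          case False
          then have "s \<in> {\<tau>..y}" "p s \<le> M" "\<psi> s = exp (- L * s)"
            using True gs by (auto simp: \<tau>_def y_def \<psi>_def max_def)
          then have "p s * \<psi> s \<le> indicator {\<tau>..y} s *\<^sub>R (M * exp (- L * s))"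
            by simp
          then show ?thesis using pos[of t] b0[of s] by (smt (verit) mult_nonneg_nonneg)
        qed
        then show ?thesis using True by simp
      qed (use pos[of t] b0[of s] \<open>0 < M\<close> in auto)
    qed
    also have "\<dots> = \<psi> t * (LINT s|lborel. b s) + (LINT s:{\<tau>..y}|lborel. M * exp (- L * s))"
      using b E(1) unfolding set_integrable_def set_lebesgue_integral_def
      by (subst Bochner_Integration.integral_add) auto
    also have "\<dots> \<le> \<psi> t * (e / 2) + M / L * exp (- L * \<tau>)"
      using M E(2) pos[of t] by (intro add_mono mult_left_mono) (auto simp: b_def)
    also have "\<dots> = e * \<psi> t"
      using \<open>0 < M\<close> \<open>0 < e\<close> by (simp add: L_def \<psi>_def \<tau>_def field_simps)
    finally show ?thesis .
  qed
  show ?thesis by (rule that[OF pos anti bnd int le])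
qed

section \<open>Iterated Volterra kernels and their bounds\<close>

text \<open>Convergence depends on \<open>\<kappa>\<close> only through its growth rate
  \<open>c\<close>; the special form of \<open>s2\<close> comes back with the differential equation.
  Integrability is demanded on every left half-line because the solution is built for all real
  \<open>x\<close>.\<close>

locale volterra =
  fixes \<kappa> :: "real \<Rightarrow> complex" and q :: "real \<Rightarrow> real" and c :: real
  assumes \<kappa>_meas [measurable]: "\<kappa> \<in> borel_measurable borel"
    and \<kappa>_bound: "0 \<le> r \<Longrightarrow> norm (\<kappa> r) \<le> exp (c * r)"
    and c_nonneg: "0 \<le> c"
    and q_meas [measurable]: "q \<in> borel_measurable borel"
    and q_int: "set_integrable lborel {..x} (\<lambda>t. q t * exp (2 * c * \<bar>t\<bar>))"
begin

definition p :: "real \<Rightarrow> real" where "p t = \<bar>q t\<bar> * exp (2 * c * \<bar>t\<bar>)"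

lemma p_meas [measurable]: "p \<in> borel_measurable borel"
  unfolding p_def by measurable

lemma p_int: "set_integrable lborel {..x} p"
  using set_integrable_abs[OF q_int[of x]] by (simp add: p_def[abs_def] abs_mult)

lemma p_nonneg: "0 \<le> p t" by (simp add: p_def)

lemma q_le_p: "\<bar>q t\<bar> \<le> p t"
  using c_nonneg by (simp add: p_def mult_le_cancel_left1)

definition P :: "real \<Rightarrow> real" where "P x = (LINT t:{..x}|lborel. p t)"

lemma P_nonneg: "0 \<le> P x"
  unfolding P_def set_lebesgue_integral_def by (rule Bochner_Integration.integral_nonneg) (simp add: p_nonneg)

lemma P_mono: "x \<le> y \<Longrightarrow> P x \<le> P y"
  unfolding P_def set_lebesgue_integral_def
  using p_int p_nonneg
  by (intro integral_mono) (auto simp: set_integrable_def split: split_indicator)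

text \<open>The tail of a convergent integral. \<open>P x\<close> is the factor by which
  \<open>T y\<close> is bounded, so this yields the asymptotics of the Jost solution.\<close>

lemma P_at_bot: "(P \<longlongrightarrow> 0) at_bot"
proof -
  have "((\<lambda>y. LINT t|lborel. indicator {..- y} t *\<^sub>R p t) \<longlongrightarrow> (LINT t::real|lborel. 0::real)) at_top"
  proof (rule integral_dominated_convergence_at_top)
    show "integrable lborel (\<lambda>t. indicator {..0} t *\<^sub>R p t)"
      using p_int[of 0] by (simp add: set_integrable_def)
    show "eventually (\<lambda>y. AE t in lborel. norm (indicator {..- y} t *\<^sub>R p t) \<le> indicator {..0} t *\<^sub>R p t) at_top"
      using eventually_ge_at_top[of 0]
      by eventually_elim (auto simp: p_nonneg split: split_indicator)
    show "AE t in lborel. ((\<lambda>y. indicator {..- y} t *\<^sub>R p t) \<longlongrightarrow> 0) at_top"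
    proof (rule AE_I2)
      fix t
      have "eventually (\<lambda>y. indicator {..- y} t *\<^sub>R p t = 0) at_top"
        using eventually_gt_at_top[of "- t"] by eventually_elim simp
      then show "((\<lambda>y. indicator {..- y} t *\<^sub>R p t) \<longlongrightarrow> 0) at_top" by (rule tendsto_eventually)
    qed
  qed measurable
  then have "((\<lambda>y. P (- y)) \<longlongrightarrow> 0) at_top" by (simp add: P_def set_lebesgue_integral_def)
  then show ?thesis by (simp add: filterlim_at_bot_mirror)
qed

text \<open>The index is shifted: \<open>K n\<close> is the paper's \<open>K\<^sub>n\<^sub>+\<^sub>1\<close>.\<close>

primrec K :: "nat \<Rightarrow> real \<Rightarrow> real \<Rightarrow> complex" where
  "K 0 x t = \<kappa> (x - t)"
| "K (Suc n) x t = (LINT s:{t..x}|lborel. K n x s * of_real (q s) * \<kappa> (s - t))"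

lemma K_meas [measurable]: "K n x \<in> borel_measurable borel"
proof (induction n)
  case 0
  then show ?case by (simp add: K.simps(1)[abs_def])
next
  case (Suc n)
  note [measurable] = Suc.IH
  \<comment> \<open>The domain \<open>{t..x}\<close> depends on the parameter \<open>t\<close>;
    moved into the integrand, it becomes a jointly measurable condition on \<open>s\<close> and
    \<open>t\<close>.\<close>
  have eq: "K (Suc n) x = (\<lambda>t. LINT s|lborel. (if t \<le> s \<and> s \<le> x then K n x s * of_real (q s) * \<kappa> (s - t) else 0))"
    by (rule ext) (auto simp: set_lebesgue_integral_def intro!: Bochner_Integration.integral_cong split: split_indicator)
  show ?case unfolding eq by measurable
qed

text \<open>The exponentials in the recursion multiply to \<open>exp (c * (x - t))\<close> exactly,
  so only \<open>p s * \<psi> s\<close> is left to integrate, and this gives back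
  \<open>\<psi> t\<close> with one more factor \<open>e\<close>. The resulting ratio
  \<open>\<psi> t / \<psi> x\<close> is at most \<open>B / \<psi> X\<close>, a constant independent
  of \<open>n\<close>, \<open>t\<close> and \<open>x\<close>.\<close>

lemma K_bound:
  assumes "0 < e"
  obtains B where "0 \<le> B" "\<And>n t x. \<lbrakk>t \<le> x; x \<le> X\<rbrakk> \<Longrightarrow> norm (K n x t) \<le> B * exp (c * (x - t)) * e ^ n"
proof -
  obtain \<psi> B where pos: "\<And>t. 0 < \<psi> t" and anti: "\<And>s t. s \<le> t \<Longrightarrow> \<psi> t \<le> \<psi> s" and B: "\<And>t. \<psi> t \<le> B"
    and int: "\<And>t x. \<lbrakk>t \<le> x; x \<le> X\<rbrakk> \<Longrightarrow> set_integrable lborel {t..x} (\<lambda>s. p s * \<psi> s)"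
    and le: "\<And>t x. \<lbrakk>t \<le> x; x \<le> X\<rbrakk> \<Longrightarrow> (LINT s:{t..x}|lborel. p s * \<psi> s) \<le> e * \<psi> t"
    by (rule decreasing_weight[OF p_int[of X] p_meas p_nonneg \<open>0 < e\<close>]) (rule that)
  have claim: "norm (K n x t) \<le> exp (c * (x - t)) * e ^ n / \<psi> x * \<psi> t" if "t \<le> x" "x \<le> X" for n t x
    using that(1)
  proof (induction n arbitrary: t)
    case 0
    have "norm (K 0 x t) \<le> exp (c * (x - t)) * 1" using 0 by (simp add: \<kappa>_bound)
    \<comment> \<open>The weight decreases, so inserting \<open>\<psi> t / \<psi> x \<ge> 1\<close>
      loses nothing and starts the induction.\<close>
    also have "\<dots> \<le> exp (c * (x - t)) * (\<psi> t / \<psi> x)"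
      using anti[OF 0] pos[of x] by (intro mult_left_mono) auto
    finally show ?case by simp
  next
    case (Suc n)
    define C where "C = exp (c * (x - t)) * e ^ n / \<psi> x"
    have "C \<ge> 0" using \<open>0 < e\<close> pos[of x] by (simp add: C_def)
    have "norm (K (Suc n) x t) \<le> (LINT s:{t..x}|lborel. C * (p s * \<psi> s))"
      unfolding K.simps
    proof (rule set_integral_dominated(2))
      show "set_integrable lborel {t..x} (\<lambda>s. C * (p s * \<psi> s))"
        using int[OF Suc.prems that(2)] by simp
      fix s assume s: "s \<in> {t..x}"
      have "norm (K n x s * of_real (q s) * \<kappa> (s - t)) = norm (K n x s) * \<bar>q s\<bar> * norm (\<kappa> (s - t))"
        by (simp add: norm_mult)
      also have "\<dots> \<le> (exp (c * (x - s)) * e ^ n / \<psi> x * \<psi> s) * p s * exp (c * (s - t))"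
        using s \<open>0 < e\<close> pos less_imp_le[OF pos] p_nonneg Suc.IH[of s]
        by (intro mult_mono \<kappa>_bound q_le_p) auto
      also have "\<dots> = (exp (c * (x - s)) * exp (c * (s - t))) * e ^ n / \<psi> x * (p s * \<psi> s)"
        by simp
      also have "exp (c * (x - s)) * exp (c * (s - t)) = exp (c * (x - t))"
        by (simp add: algebra_simps flip: exp_add)
      finally show "norm (K n x s * of_real (q s) * \<kappa> (s - t)) \<le> C * (p s * \<psi> s)"
        by (simp add: C_def)
    qed auto
    also have "\<dots> = C * (LINT s:{t..x}|lborel. p s * \<psi> s)" by simp
    also have "\<dots> \<le> C * (e * \<psi> t)"
      using le[OF Suc.prems that(2)] \<open>C \<ge> 0\<close> by (rule mult_left_mono)
    finally show ?case by (simp add: C_def mult_ac)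
  qed
  show ?thesis
  proof (rule that[of "B / \<psi> X"])
    have "0 \<le> B" using pos[of X] B[of X] by linarith
    then show "0 \<le> B / \<psi> X" using pos[of X] by simp
    fix n t x assume tx: "t \<le> x" "x \<le> X"
    have "\<psi> t / \<psi> x \<le> B / \<psi> X"
      using B pos anti[OF tx(2)] \<open>0 \<le> B\<close> by (intro frac_le) auto
    then have "exp (c * (x - t)) * e ^ n * (\<psi> t / \<psi> x) \<le> exp (c * (x - t)) * e ^ n * (B / \<psi> X)"
      using \<open>0 < e\<close> by (intro mult_left_mono) auto
    with claim[OF tx, of n] show "norm (K n x t) \<le> B / \<psi> X * exp (c * (x - t)) * e ^ n"
      by (simp add: mult_ac)
  qed
qed

text \<open>For a fixed \<open>n\<close> the ratio 1 is good enough. The integrals in the recursion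
  are thereby genuine and not the default value 0.\<close>

lemma K_integrand_integrable:
  assumes "t \<le> x"
  shows "set_integrable lborel {t..x} (\<lambda>s. K n x s * of_real (q s) * \<kappa> (s - t))"
proof -
  obtain B where "0 \<le> B" and B: "\<And>n t y. \<lbrakk>t \<le> y; y \<le> x\<rbrakk> \<Longrightarrow> norm (K n y t) \<le> B * exp (c * (y - t)) * 1 ^ n"
    using K_bound[of 1 x] by auto
  show ?thesis
  proof (rule set_integral_dominated(1))
    show "set_integrable lborel {t..x} (\<lambda>s. (B * exp (c * (x - t))) * p s)"
      by (intro set_integrable_mult_right set_integrable_subset[OF p_int[of x]]) auto
    fix s assume s: "s \<in> {t..x}"
    have "norm (K n x s * of_real (q s) * \<kappa> (s - t)) = norm (K n x s) * \<bar>q s\<bar> * norm (\<kappa> (s - t))"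
      by (simp add: norm_mult)
    also have "\<dots> \<le> (B * exp (c * (x - s)) * 1 ^ n) * p s * exp (c * (s - t))"
      using s \<open>0 \<le> B\<close> p_nonneg
      by (intro mult_mono \<kappa>_bound q_le_p B) auto
    also have "\<dots> = B * (exp (c * (x - s)) * exp (c * (s - t))) * p s"
      by simp
    also have "exp (c * (x - s)) * exp (c * (s - t)) = exp (c * (x - t))"
      by (simp add: algebra_simps flip: exp_add)
    finally show "norm (K n x s * of_real (q s) * \<kappa> (s - t)) \<le> (B * exp (c * (x - t))) * p s" .
  qed auto
qed

end

section \<open>Powers of the Volterra operator\<close>

context volterra begin

text \<open>The growth class on which the operator acts: it contains the plane waves and is
  preserved by \<open>G 0\<close>. The constant may depend on the right end \<open>X\<close>, since
  nothing is known about growth at \<open>+\<infinity>\<close>.\<close>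

definition admissible :: "(real \<Rightarrow> complex) \<Rightarrow> bool" where
  "admissible f \<longleftrightarrow> f \<in> borel_measurable borel \<and>
     (\<forall>X. \<exists>C\<ge>0. \<forall>t\<le>X. norm (f t) \<le> C * exp (c * \<bar>t\<bar>))"

lemma admissibleD:
  assumes "admissible f"
  shows "f \<in> borel_measurable borel"
    and "\<exists>C\<ge>0. \<forall>t\<le>X. norm (f t) \<le> C * exp (c * \<bar>t\<bar>)"
  using assms by (auto simp: admissible_def)

text \<open>\<open>G 0\<close> is the Volterra operator itself, and \<open>G n\<close> turns out to
  be its power with exponent \<open>Suc n\<close>.\<close>

definition G :: "nat \<Rightarrow> (real \<Rightarrow> complex) \<Rightarrow> real \<Rightarrow> complex" where
  "G n f x = (LINT t:{..x}|lborel. K n x t * of_real (q t) * f t)"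

text \<open>Origin of the factor 2 in the weight: one \<open>c * \<bar>t\<bar>\<close> comes from
  the kernel, by \<open>- t \<le> \<bar>t\<bar>\<close>, and one from the growth of the function it
  is applied to.\<close>

lemma exp_weight_le: "exp (c * (x - t)) * \<bar>q t\<bar> * exp (c * \<bar>t\<bar>) \<le> exp (c * x) * p t"
proof -
  have "exp (c * (x - t)) * exp (c * \<bar>t\<bar>) = exp (c * (x - t + \<bar>t\<bar>))"
    by (simp add: distrib_left flip: exp_add)
  also have "\<dots> \<le> exp (c * (x + 2 * \<bar>t\<bar>))"
    using c_nonneg by (intro exp_mono mult_left_mono) auto
  also have "\<dots> = exp (c * x) * exp (2 * c * \<bar>t\<bar>)"
    by (simp add: distrib_left mult_ac flip: exp_add)
  finally have "exp (c * (x - t)) * exp (c * \<bar>t\<bar>) * \<bar>q t\<bar> \<le> exp (c * x) * exp (2 * c * \<bar>t\<bar>) * \<bar>q t\<bar>"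
    by (rule mult_right_mono) simp
  then show ?thesis by (simp add: p_def mult_ac)
qed

text \<open>The kernel \<open>k\<close> is kept general so that the bound covers the
  \<open>K n\<close> as well as the single exponentials into which \<open>s2\<close> is split
  later.\<close>

lemma kernel_integral_bound:
  fixes f k :: "real \<Rightarrow> complex"
  assumes "f \<in> borel_measurable borel" "k \<in> borel_measurable borel" "0 \<le> B" "0 \<le> C"
    and k: "\<And>t. t \<le> x \<Longrightarrow> norm (k t) \<le> B * exp (c * (x - t))"
    and f: "\<And>t. t \<le> x \<Longrightarrow> norm (f t) \<le> C * exp (c * \<bar>t\<bar>)"
  shows "set_integrable lborel {..x} (\<lambda>t. k t * of_real (q t) * f t)"
    and "(LINT t:{..x}|lborel. norm (k t * of_real (q t) * f t)) \<le> B * C * exp (c * x) * P x"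
    and "norm (LINT t:{..x}|lborel. k t * of_real (q t) * f t) \<le> B * C * exp (c * x) * P x"
proof -
  note [measurable] = assms(1,2)
  have le: "norm (k t * of_real (q t) * f t) \<le> B * C * exp (c * x) * p t" if "t \<le> x" for t
  proof -
    have "norm (k t * of_real (q t) * f t) = norm (k t) * \<bar>q t\<bar> * norm (f t)" by (simp add: norm_mult)
    also have "\<dots> \<le> (B * exp (c * (x - t))) * \<bar>q t\<bar> * (C * exp (c * \<bar>t\<bar>))"
      using that assms(3,4) by (intro mult_mono k f) auto
    also have "\<dots> = (B * C) * (exp (c * (x - t)) * \<bar>q t\<bar> * exp (c * \<bar>t\<bar>))" by simp
    also have "\<dots> \<le> (B * C) * (exp (c * x) * p t)"
      using assms(3,4) by (intro mult_left_mono exp_weight_le) auto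
    finally show ?thesis by (simp add: mult.assoc)
  qed
  have int: "set_integrable lborel {..x} (\<lambda>t. B * C * exp (c * x) * p t)"
    using p_int[of x] by simp
  have P: "(LINT t:{..x}|lborel. B * C * exp (c * x) * p t) = B * C * exp (c * x) * P x"
    by (simp add: P_def)
  show int': "set_integrable lborel {..x} (\<lambda>t. k t * of_real (q t) * f t)"
    by (rule set_integral_dominated(1)[OF _ _ int le]) auto
  show "norm (LINT t:{..x}|lborel. k t * of_real (q t) * f t) \<le> B * C * exp (c * x) * P x"
    unfolding P[symmetric] by (rule set_integral_dominated(2)[OF _ _ int le]) auto
  show "(LINT t:{..x}|lborel. norm (k t * of_real (q t) * f t)) \<le> B * C * exp (c * x) * P x"
    unfolding P[symmetric]
    by (rule set_integral_mono[OF set_integrable_norm[OF int'] int]) (use le in auto)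
qed

lemma G_bound:
  assumes f: "admissible f" and "0 < e"
  obtains D where "0 \<le> D"
    "\<And>n x. x \<le> X \<Longrightarrow> set_integrable lborel {..x} (\<lambda>t. K n x t * of_real (q t) * f t)"
    "\<And>n x. x \<le> X \<Longrightarrow> (LINT t:{..x}|lborel. norm (K n x t * of_real (q t) * f t)) \<le> D * e ^ n * exp (c * x) * P x"
    "\<And>n x. x \<le> X \<Longrightarrow> norm (G n f x) \<le> D * e ^ n * exp (c * x) * P x"
proof -
  obtain C where "0 \<le> C" and C: "\<And>t. t \<le> X \<Longrightarrow> norm (f t) \<le> C * exp (c * \<bar>t\<bar>)"
    using admissibleD(2)[OF f, of X] by auto
  obtain B where "0 \<le> B" and B: "\<And>n t x. \<lbrakk>t \<le> x; x \<le> X\<rbrakk> \<Longrightarrow> norm (K n x t) \<le> B * exp (c * (x - t)) * e ^ n"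
    using K_bound[OF \<open>0 < e\<close>, of X] by auto
  have "0 \<le> B * e ^ n" for n using \<open>0 \<le> B\<close> \<open>0 < e\<close> by simp
  note * = kernel_integral_bound[OF admissibleD(1)[OF f] K_meas this \<open>0 \<le> C\<close>]
  show ?thesis
  proof (rule that[of "B * C"])
    show "0 \<le> B * C" using \<open>0 \<le> B\<close> \<open>0 \<le> C\<close> by simp
    fix n x assume x: "x \<le> X"
    have k: "norm (K n x t) \<le> B * e ^ n * exp (c * (x - t))" if "t \<le> x" for t
      using B[OF that x, of n] by (simp add: mult_ac)
    have f': "norm (f t) \<le> C * exp (c * \<bar>t\<bar>)" if "t \<le> x" for t
      using C[of t] that x by simp
    show "set_integrable lborel {..x} (\<lambda>t. K n x t * of_real (q t) * f t)"
      by (rule *(1)[OF k f'])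
    have eq: "B * e ^ n * C * exp (c * x) * P x = B * C * e ^ n * exp (c * x) * P x" by simp
    show "(LINT t:{..x}|lborel. norm (K n x t * of_real (q t) * f t)) \<le> B * C * e ^ n * exp (c * x) * P x"
      unfolding eq[symmetric] by (rule *(2)[OF k f'])
    show "norm (G n f x) \<le> B * C * e ^ n * exp (c * x) * P x"
      unfolding eq[symmetric] G_def by (rule *(3)[OF k f'])
  qed
qed

lemma exp_abs_le: "exp (c * x) \<le> exp (c * \<bar>x\<bar>)"
  using c_nonneg by (intro exp_mono mult_left_mono) auto

lemma admissible_G0:
  assumes f: "admissible f"
  shows "admissible (G 0 f)"
  unfolding admissible_def
proof (intro conjI allI)
  note [measurable] = admissibleD(1)[OF f]
  have eq: "G 0 f = (\<lambda>x. LINT t|lborel. (if t \<le> x then \<kappa> (x - t) * of_real (q t) * f t else 0))"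
    by (rule ext) (auto simp: G_def set_lebesgue_integral_def intro!: Bochner_Integration.integral_cong split: split_indicator)
  show "G 0 f \<in> borel_measurable borel" unfolding eq by measurable
  fix X
  obtain D where "0 \<le> D" and D: "\<And>n x. x \<le> X \<Longrightarrow> norm (G n f x) \<le> D * 1 ^ n * exp (c * x) * P x"
    using G_bound[OF f, of 1 X] by (metis zero_less_one)
  show "\<exists>C\<ge>0. \<forall>x\<le>X. norm (G 0 f x) \<le> C * exp (c * \<bar>x\<bar>)"
  proof (intro exI[of _ "D * P X"] conjI allI impI)
    show "0 \<le> D * P X" using \<open>0 \<le> D\<close> P_nonneg by simp
    fix x assume "x \<le> X"
    have "norm (G 0 f x) \<le> D * exp (c * x) * P x" using D[OF \<open>x \<le> X\<close>, of 0] by simp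
    also have "\<dots> \<le> D * exp (c * \<bar>x\<bar>) * P X"
      using \<open>0 \<le> D\<close> P_nonneg P_mono[OF \<open>x \<le> X\<close>] exp_abs_le by (intro mult_mono) auto
    finally show "norm (G 0 f x) \<le> D * P X * exp (c * \<bar>x\<bar>)" by (simp add: mult_ac)
  qed
qed

text \<open>Fubini's theorem on \<open>t \<le> s \<le> x\<close>: integrating in \<open>t\<close>
  first leaves \<open>K n\<close> acting on \<open>G 0 f\<close>, integrating in \<open>s\<close>
  first reproduces the recursion of \<open>K\<close>. The inner integral of the norm grows like
  \<open>exp (c * s)\<close>, which with \<open>exp (c * (x - s))\<close> leaves a constant multiple
  of \<open>p s\<close>.\<close>

lemma G_Suc:
  assumes f: "admissible f"
  shows "G (Suc n) f x = G n (G 0 f) x"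
proof -
  note [measurable] = admissibleD(1)[OF f] admissibleD(1)[OF admissible_G0[OF f]]
  define \<Phi> where "\<Phi> = (\<lambda>s t. if t \<le> s \<and> s \<le> x
     then K n x s * of_real (q s) * \<kappa> (s - t) * of_real (q t) * f t else 0)"
  obtain D where "0 \<le> D"
    and D1: "\<And>n y. y \<le> x \<Longrightarrow> set_integrable lborel {..y} (\<lambda>t. K n y t * of_real (q t) * f t)"
    and D2: "\<And>n y. y \<le> x \<Longrightarrow> (LINT t:{..y}|lborel. norm (K n y t * of_real (q t) * f t)) \<le> D * 1 ^ n * exp (c * y) * P y"
    and "\<And>n y. y \<le> x \<Longrightarrow> norm (G n f y) \<le> D * 1 ^ n * exp (c * y) * P y"
    by (rule G_bound[OF f zero_less_one, of x]) (rule that)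
  obtain B where "0 \<le> B" and B: "\<And>n t y. \<lbrakk>t \<le> y; y \<le> x\<rbrakk> \<Longrightarrow> norm (K n y t) \<le> B * exp (c * (y - t)) * 1 ^ n"
    using K_bound[of 1 x] by auto
  have \<Phi>1: "\<Phi> s t = (indicator {..x} s *\<^sub>R (K n x s * of_real (q s))) *
      (indicator {..s} t *\<^sub>R (K 0 s t * of_real (q t) * f t))" for s t
    by (auto simp: \<Phi>_def)
  have "integrable (lborel \<Otimes>\<^sub>M lborel) (case_prod \<Phi>)"
  proof (rule lborel_pair.Fubini_integrable)
    show [measurable]: "case_prod \<Phi> \<in> borel_measurable (lborel \<Otimes>\<^sub>M lborel)"
      unfolding \<Phi>_def by measurable
    show "AE s in lborel. integrable lborel (\<lambda>t. case (s, t) of (s, t) \<Rightarrow> \<Phi> s t)"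
    proof (rule AE_I2)
      fix s
      show "integrable lborel (\<lambda>t. case (s, t) of (s, t) \<Rightarrow> \<Phi> s t)"
      proof (cases "s \<le> x")
        case True
        show ?thesis using D1[OF True, of 0] unfolding prod.case \<Phi>1 set_integrable_def
          by (intro integrable_mult_right) simp
      qed (simp add: \<Phi>_def)
    qed
    show "integrable lborel (\<lambda>s. LINT t|lborel. norm (case (s, t) of (s, t) \<Rightarrow> \<Phi> s t))"
    proof (rule Bochner_Integration.integrable_bound)
      show "integrable lborel (\<lambda>s. B * D * exp (c * x) * P x * (indicator {..x} s *\<^sub>R p s))"
        using p_int[of x] unfolding set_integrable_def by (rule integrable_mult_right)
      show "AE s in lborel. norm (LINT t|lborel. norm (case (s, t) of (s, t) \<Rightarrow> \<Phi> s t))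
          \<le> norm (B * D * exp (c * x) * P x * (indicator {..x} s *\<^sub>R p s))"
      proof (rule AE_I2)
        fix s
        show "norm (LINT t|lborel. norm (case (s, t) of (s, t) \<Rightarrow> \<Phi> s t))
          \<le> norm (B * D * exp (c * x) * P x * (indicator {..x} s *\<^sub>R p s))"
        proof (cases "s \<le> x")
          case True
          have "(LINT t|lborel. norm (\<Phi> s t))
              = norm (K n x s) * \<bar>q s\<bar> * (LINT t:{..s}|lborel. norm (K 0 s t * of_real (q t) * f t))"
            unfolding \<Phi>1 set_lebesgue_integral_def norm_mult using True by (simp add: norm_mult)
          also have "\<dots> \<le> (B * exp (c * (x - s))) * \<bar>q s\<bar> * (D * exp (c * s) * P s)"
            using B[OF True order_refl, of n] D2[OF True, of 0] \<open>0 \<le> B\<close>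
            by (intro mult_mono) (auto intro!: Bochner_Integration.integral_nonneg simp: set_lebesgue_integral_def)
          also have "\<dots> \<le> (B * exp (c * (x - s))) * p s * (D * exp (c * s) * P x)"
            using P_mono[OF True] P_nonneg p_nonneg q_le_p \<open>0 \<le> D\<close> \<open>0 \<le> B\<close> by (intro mult_mono) auto
          also have "\<dots> = B * D * (exp (c * (x - s)) * exp (c * s)) * P x * p s" by simp
          also have "exp (c * (x - s)) * exp (c * s) = exp (c * x)"
            by (simp add: algebra_simps flip: exp_add)
          finally have "(LINT t|lborel. norm (\<Phi> s t)) \<le> B * D * exp (c * x) * P x * p s" .
          moreover have "0 \<le> (LINT t|lborel. norm (\<Phi> s t))"
            by (rule Bochner_Integration.integral_nonneg) simp
          moreover have "0 \<le> B * D * exp (c * x) * P x * p s"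
            using P_nonneg p_nonneg \<open>0 \<le> D\<close> \<open>0 \<le> B\<close> by simp
          ultimately show ?thesis using True unfolding prod.case real_norm_def by simp
        qed (simp add: \<Phi>_def)
      qed
    qed measurable
  qed
  then have "(LINT t|lborel. LINT s|lborel. \<Phi> s t) = (LINT s|lborel. LINT t|lborel. \<Phi> s t)"
    by (rule lborel_pair.Fubini_integral)
  moreover have "(LINT t|lborel. \<Phi> s t) = indicator {..x} s *\<^sub>R (K n x s * of_real (q s) * G 0 f s)" for s
    unfolding \<Phi>1 G_def set_lebesgue_integral_def by (subst integral_mult_right_zero) simp
  moreover have "(LINT s|lborel. \<Phi> s t) = indicator {..x} t *\<^sub>R (K (Suc n) x t * of_real (q t) * f t)" for t
  proof -
    have "\<Phi> s t = (indicator {t..x} s *\<^sub>R (K n x s * of_real (q s) * \<kappa> (s - t))) * (of_real (q t) * f t)" for s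
      by (auto simp: \<Phi>_def split: split_indicator)
    then have "(LINT s|lborel. \<Phi> s t) = K (Suc n) x t * (of_real (q t) * f t)"
      unfolding K.simps set_lebesgue_integral_def by (simp only: integral_mult_left_zero)
    \<comment> \<open>The recursion integrates over an empty interval here, in agreement with the
      indicator of \<open>{..x}\<close>.\<close>
    moreover have "K (Suc n) x t = 0" if "x < t"
      using that by (simp add: set_lebesgue_integral_def)
    ultimately show ?thesis by (cases "t \<le> x") (auto simp del: K.simps)
  qed
  ultimately show ?thesis
    unfolding G_def[of "Suc n"] G_def[of n] set_lebesgue_integral_def by simp
qed

lemma admissible_funpow: "admissible f \<Longrightarrow> admissible ((G 0 ^^ n) f)"
  by (induction n) (auto intro: admissible_G0)

lemma G_eq_funpow: "admissible f \<Longrightarrow> G n f x = (G 0 ^^ Suc n) f x"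
proof (induction n arbitrary: f)
  case (Suc n)
  have "G (Suc n) f x = (G 0 ^^ Suc n) (G 0 f) x"
    using Suc by (simp only: G_Suc admissible_G0)
  then show ?case by (simp only: funpow_Suc_right o_apply)
qed simp

section \<open>Neumann series and resolvent kernel\<close>

text \<open>With this ratio in the kernel bounds, \<open>w ^ n\<close> times the bound falls like
  \<open>(1 / 2) ^ n\<close>; the summand 1 covers \<open>w = 0\<close>.\<close>

lemma power_mult_half:
  fixes w :: complex
  shows "norm (w ^ n) * (1 / (2 * (norm w + 1))) ^ n \<le> (1 / 2) ^ n"
proof -
  have "norm w * (1 / (2 * (norm w + 1))) \<le> 1 / 2"
    using add_nonneg_pos[OF norm_ge_zero[of w] zero_less_one] by (simp add: field_simps)
  then have "(norm w * (1 / (2 * (norm w + 1)))) ^ n \<le> (1 / 2) ^ n"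
    by (intro power_mono) auto
  then show ?thesis by (simp only: power_mult_distrib norm_power)
qed

lemma half_series: "summable (\<lambda>n. D * (1 / 2 :: real) ^ n)" "(\<Sum>n. D * (1 / 2 :: real) ^ n) = 2 * D"
  by (auto simp: suminf_mult suminf_geometric summable_mult summable_geometric)

definition N :: "complex \<Rightarrow> real \<Rightarrow> real \<Rightarrow> complex" where
  "N w x t = (\<Sum>n. w ^ Suc n * K n x t)"

lemma N_summable:
  assumes "t \<le> x"
  shows "summable (\<lambda>n. norm (w ^ Suc n * K n x t))"
proof -
  have "0 < 1 / (2 * (norm w + 1))" by (intro divide_pos_pos mult_pos_pos add_nonneg_pos) auto
  from K_bound[OF this, of x] obtain B where "0 \<le> B"
    and B: "\<And>n t y. \<lbrakk>t \<le> y; y \<le> x\<rbrakk> \<Longrightarrow> norm (K n y t) \<le> B * exp (c * (y - t)) * (1 / (2 * (norm w + 1))) ^ n"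
    by metis
  let ?E = "norm w * (B * exp (c * (x - t)))"
  show ?thesis
  proof (rule summable_comparison_test')
    show "summable (\<lambda>n. ?E * (1 / 2) ^ n)" by (rule half_series)
    fix n
    have "norm (w ^ Suc n * K n x t) = norm w * norm (w ^ n) * norm (K n x t)"
      by (simp add: norm_mult norm_power)
    also have "\<dots> \<le> norm w * norm (w ^ n) * (B * exp (c * (x - t)) * (1 / (2 * (norm w + 1))) ^ n)"
      using B[OF assms order_refl, of n] by (intro mult_left_mono) auto
    also have "\<dots> = ?E * (norm (w ^ n) * (1 / (2 * (norm w + 1))) ^ n)" by simp
    also have "\<dots> \<le> ?E * (1 / 2) ^ n"
      using \<open>0 \<le> B\<close> by (intro mult_left_mono power_mult_half) auto
    finally show "norm (norm (w ^ Suc n * K n x t)) \<le> ?E * (1 / 2) ^ n" by simp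
  qed
qed

text \<open>Defined by the resolvent formula that is to be proved; the Neumann series is derived
  from it and then gives the fixed-point equation.\<close>

definition u :: "complex \<Rightarrow> (real \<Rightarrow> complex) \<Rightarrow> real \<Rightarrow> complex" where
  "u w f x = f x + (LINT t:{..x}|lborel. N w x t * of_real (q t) * f t)"

lemma iterate_bound:
  assumes f: "admissible f"
  obtains D where "0 \<le> D" "\<And>n t. t \<le> X \<Longrightarrow> norm (w ^ n * (G 0 ^^ n) f t) \<le> D * (1 / 2) ^ n * exp (c * \<bar>t\<bar>)"
proof -
  define e where "e = 1 / (2 * (norm w + 1))"
  have "0 < e" unfolding e_def by (intro divide_pos_pos mult_pos_pos add_nonneg_pos) auto
  from G_bound[OF f this, of X] obtain E where "0 \<le> E"
    and E: "\<And>n x. x \<le> X \<Longrightarrow> norm (G n f x) \<le> E * e ^ n * exp (c * x) * P x"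
    by metis
  obtain C where "0 \<le> C" and C: "\<And>t. t \<le> X \<Longrightarrow> norm (f t) \<le> C * exp (c * \<bar>t\<bar>)"
    using admissibleD(2)[OF f, of X] by auto
  \<comment> \<open>\<open>C\<close> serves the iterate 0. The iterate \<open>Suc m\<close> is
    \<open>G m f\<close>, whose bound has only \<open>e ^ m\<close>, hence the division by
    \<open>e\<close>.\<close>
  define D where "D = max C (E * P X / e)"
  have "0 \<le> D" using \<open>0 \<le> C\<close> by (simp add: D_def)
  show ?thesis
  proof (rule that[OF \<open>0 \<le> D\<close>])
    fix n t assume t: "t \<le> X"
    have "norm ((G 0 ^^ n) f t) \<le> D * e ^ n * exp (c * \<bar>t\<bar>)"
    proof (cases n)
      case 0
      have "norm (f t) \<le> C * exp (c * \<bar>t\<bar>)" by (rule C[OF t])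
      also have "\<dots> \<le> D * exp (c * \<bar>t\<bar>)" by (simp add: D_def)
      finally show ?thesis using 0 by simp
    next
      case (Suc m)
      have "norm ((G 0 ^^ n) f t) \<le> E * e ^ m * exp (c * t) * P t"
        using E[OF t, of m] unfolding G_eq_funpow[OF f] Suc .
      also have "\<dots> \<le> E * e ^ m * exp (c * \<bar>t\<bar>) * P X"
        using \<open>0 \<le> E\<close> \<open>0 < e\<close> P_nonneg P_mono[OF t] exp_abs_le by (intro mult_mono) auto
      also have "\<dots> = (E * P X / e) * e ^ n * exp (c * \<bar>t\<bar>)"
        using \<open>0 < e\<close> by (simp add: Suc)
      also have "\<dots> \<le> D * e ^ n * exp (c * \<bar>t\<bar>)"
        using \<open>0 < e\<close> by (intro mult_right_mono) (auto simp: D_def)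
      finally show ?thesis .
    qed
    then have "norm (w ^ n) * norm ((G 0 ^^ n) f t) \<le> norm (w ^ n) * (D * e ^ n * exp (c * \<bar>t\<bar>))"
      by (rule mult_left_mono) simp
    also have "\<dots> = D * (norm (w ^ n) * e ^ n) * exp (c * \<bar>t\<bar>)" by simp
    also have "\<dots> \<le> D * (1 / 2) ^ n * exp (c * \<bar>t\<bar>)"
      using \<open>0 \<le> D\<close> power_mult_half[of w n] unfolding e_def by (intro mult_mono) auto
    finally show "norm (w ^ n * (G 0 ^^ n) f t) \<le> D * (1 / 2) ^ n * exp (c * \<bar>t\<bar>)"
      by (simp add: norm_mult)
  qed
qed

text \<open>Sum and integral are exchanged by absolute convergence; this is why
  \<open>G_bound\<close> controls the integral of the norm and not just
  \<open>G n f\<close>.\<close>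

lemma N_integral:
  assumes f: "admissible f"
  shows "set_integrable lborel {..x} (\<lambda>t. N w x t * of_real (q t) * f t)"
    and "(LINT t:{..x}|lborel. N w x t * of_real (q t) * f t) = (\<Sum>n. w ^ Suc n * (G 0 ^^ Suc n) f x)"
proof -
  note [measurable] = admissibleD(1)[OF f]
  define e where "e = 1 / (2 * (norm w + 1))"
  have "0 < e" unfolding e_def by (intro divide_pos_pos mult_pos_pos add_nonneg_pos) auto
  obtain D where "0 \<le> D"
    and D1: "\<And>n y. y \<le> x \<Longrightarrow> set_integrable lborel {..y} (\<lambda>t. K n y t * of_real (q t) * f t)"
    and D2: "\<And>n y. y \<le> x \<Longrightarrow> (LINT t:{..y}|lborel. norm (K n y t * of_real (q t) * f t)) \<le> D * e ^ n * exp (c * y) * P y"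
    and "\<And>n y. y \<le> x \<Longrightarrow> norm (G n f y) \<le> D * e ^ n * exp (c * y) * P y"
    by (rule G_bound[OF f \<open>0 < e\<close>, of x]) (rule that)
  let ?F = "\<lambda>n t. indicator {..x} t *\<^sub>R (w ^ Suc n * (K n x t * of_real (q t) * f t))"
  have int: "integrable lborel (?F n)" for n
    using set_integrable_mult_right[OF D1[OF order_refl, of n], of "w ^ Suc n"] unfolding set_integrable_def .
  have AE: "AE t in lborel. summable (\<lambda>n. norm (?F n t))"
  proof (rule AE_I2)
    fix t
    show "summable (\<lambda>n. norm (?F n t))"
    proof (cases "t \<le> x")
      case True
      have "summable (\<lambda>n. norm (w ^ Suc n * K n x t) * norm (of_real (q t) * f t))"
        by (rule summable_mult2[OF N_summable[OF True]])
      then show ?thesis using True by (simp add: norm_mult mult_ac)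
    qed simp
  qed
  let ?E = "norm w * D * exp (c * x) * P x"
  have sums: "summable (\<lambda>n. LINT t|lborel. norm (?F n t))"
  proof (rule summable_comparison_test')
    show "summable (\<lambda>n. ?E * (1 / 2) ^ n)" by (rule half_series)
    fix n
    have "(LINT t|lborel. norm (?F n t)) = norm (w ^ Suc n) * (LINT t:{..x}|lborel. norm (K n x t * of_real (q t) * f t))"
      unfolding set_lebesgue_integral_def
      by (subst integral_mult_right_zero[symmetric], rule Bochner_Integration.integral_cong)
        (simp_all add: norm_mult)
    also have "\<dots> \<le> norm (w ^ Suc n) * (D * e ^ n * exp (c * x) * P x)"
      by (intro mult_left_mono D2 order_refl) auto
    also have "\<dots> = ?E * (norm (w ^ n) * e ^ n)" by (simp add: norm_mult norm_power)
    also have "\<dots> \<le> ?E * (1 / 2) ^ n"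
      using \<open>0 \<le> D\<close> P_nonneg power_mult_half[of w n] unfolding e_def by (intro mult_left_mono) auto
    finally show "norm (LINT t|lborel. norm (?F n t)) \<le> ?E * (1 / 2) ^ n"
      by (subst real_norm_def, subst abs_of_nonneg) (auto intro: Bochner_Integration.integral_nonneg)
  qed
  have eq: "(\<Sum>n. ?F n t) = indicator {..x} t *\<^sub>R (N w x t * of_real (q t) * f t)" for t
  proof (cases "t \<le> x")
    case True
    have "N w x t * (of_real (q t) * f t) = (\<Sum>n. w ^ Suc n * K n x t * (of_real (q t) * f t))"
      unfolding N_def by (rule suminf_mult2[OF summable_norm_cancel[OF N_summable[OF True]]])
    then show ?thesis using True by (simp add: mult.assoc)
  qed simp
  show "set_integrable lborel {..x} (\<lambda>t. N w x t * of_real (q t) * f t)"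
    using integrable_suminf[OF int AE sums] unfolding eq set_integrable_def .
  have F: "(LINT t|lborel. ?F n t) = w ^ Suc n * (G 0 ^^ Suc n) f x" for n
    unfolding G_eq_funpow[OF f, symmetric] G_def
    by (subst set_integral_mult_right[symmetric]) (simp only: set_lebesgue_integral_def)
  show "(LINT t:{..x}|lborel. N w x t * of_real (q t) * f t) = (\<Sum>n. w ^ Suc n * (G 0 ^^ Suc n) f x)"
    using integral_suminf[OF int AE sums] unfolding eq F set_lebesgue_integral_def .
qed

lemma u_summable:
  assumes f: "admissible f"
  shows "summable (\<lambda>n. norm (w ^ n * (G 0 ^^ n) f x))"
proof -
  obtain D where "\<And>n t. t \<le> x \<Longrightarrow> norm (w ^ n * (G 0 ^^ n) f t) \<le> D * (1 / 2) ^ n * exp (c * \<bar>t\<bar>)"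
    using iterate_bound[OF f] by metis
  then have "norm (norm (w ^ n * (G 0 ^^ n) f x)) \<le> D * exp (c * \<bar>x\<bar>) * (1 / 2) ^ n" for n
    by (simp add: mult_ac)
  then show ?thesis
    by (intro summable_comparison_test'[OF half_series(1)]) auto
qed

lemma u_series:
  assumes f: "admissible f"
  shows "u w f x = (\<Sum>n. w ^ n * (G 0 ^^ n) f x)"
  unfolding u_def N_integral(2)[OF f]
  using suminf_split_head[OF summable_norm_cancel[OF u_summable[OF f, of w x]]] by simp

lemma admissible_u:
  assumes f: "admissible f"
  shows "admissible (u w f)"
  unfolding admissible_def
proof (intro conjI allI)
  have [measurable]: "(G 0 ^^ n) f \<in> borel_measurable borel" for n
    by (rule admissibleD(1)[OF admissible_funpow[OF f]])
  have "u w f = (\<lambda>x. \<Sum>n. w ^ n * (G 0 ^^ n) f x)" by (rule ext) (rule u_series[OF f])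
  then show "u w f \<in> borel_measurable borel" by simp
  fix X
  obtain D where "0 \<le> D"
    and D: "\<And>n t. t \<le> X \<Longrightarrow> norm (w ^ n * (G 0 ^^ n) f t) \<le> D * (1 / 2) ^ n * exp (c * \<bar>t\<bar>)"
    using iterate_bound[OF f] by metis
  show "\<exists>C\<ge>0. \<forall>t\<le>X. norm (u w f t) \<le> C * exp (c * \<bar>t\<bar>)"
  proof (intro exI[of _ "2 * D"] conjI allI impI)
    fix t assume "t \<le> X"
    have "norm (u w f t) \<le> (\<Sum>n. D * exp (c * \<bar>t\<bar>) * (1 / 2) ^ n)"
      unfolding u_series[OF f]
      using D[OF \<open>t \<le> X\<close>] half_series(1)[of "D * exp (c * \<bar>t\<bar>)"]
      by (intro norm_suminf_le) (auto simp: mult_ac)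
    then show "norm (u w f t) \<le> 2 * D * exp (c * \<bar>t\<bar>)" by (simp add: half_series(2))
  qed (use \<open>0 \<le> D\<close> in simp)
qed

text \<open>Applied term by term, \<open>w * G 0\<close> shifts the Neumann series by one place and
  so drops exactly its head \<open>f\<close>.\<close>

lemma u_fixpoint:
  assumes f: "admissible f"
  shows "u w f x = f x + w * G 0 (u w f) x"
proof -
  have adm: "admissible ((G 0 ^^ n) f)" for n by (rule admissible_funpow[OF f])
  note [measurable] = admissibleD(1)[OF adm]
  obtain D where "0 \<le> D"
    and D: "\<And>n t. t \<le> x \<Longrightarrow> norm (w ^ n * (G 0 ^^ n) f t) \<le> D * (1 / 2) ^ n * exp (c * \<bar>t\<bar>)"
    using iterate_bound[OF f] by metis
  let ?g = "\<lambda>n t. w ^ n * (G 0 ^^ n) f t"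
  let ?F = "\<lambda>n t. indicator {..x} t *\<^sub>R (K 0 x t * of_real (q t) * ?g n t)"
  have K0: "norm (K 0 x t) \<le> 1 * exp (c * (x - t))" if "t \<le> x" for t
    using that by (simp add: \<kappa>_bound)
  have "0 \<le> D * (1 / 2) ^ n" for n using \<open>0 \<le> D\<close> by simp
  note * = kernel_integral_bound[OF _ K_meas zero_le_one this K0 D]
  have int: "integrable lborel (?F n)" for n
    using *(1)[of n] unfolding set_integrable_def by measurable
  have AE: "AE t in lborel. summable (\<lambda>n. norm (?F n t))"
    using summable_mult[OF u_summable[OF f]] by (intro AE_I2) (simp add: norm_mult mult.assoc)
  have sums: "summable (\<lambda>n. LINT t|lborel. norm (?F n t))"
  proof (rule summable_comparison_test')
    show "summable (\<lambda>n. (D * exp (c * x) * P x) * (1 / 2) ^ n)" by (rule half_series)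
    fix n
    have "(LINT t|lborel. norm (?F n t)) \<le> 1 * (D * (1 / 2) ^ n) * exp (c * x) * P x"
      using *(2)[of n] unfolding set_lebesgue_integral_def by simp
    then show "norm (LINT t|lborel. norm (?F n t)) \<le> (D * exp (c * x) * P x) * (1 / 2) ^ n"
      by (subst real_norm_def, subst abs_of_nonneg) (auto intro: Bochner_Integration.integral_nonneg simp: mult_ac)
  qed
  have eq: "(\<Sum>n. ?F n t) = indicator {..x} t *\<^sub>R (K 0 x t * of_real (q t) * u w f t)" for t
    unfolding u_series[OF f]
    using suminf_mult[OF summable_norm_cancel[OF u_summable[OF f, of w t]], of "K 0 x t * of_real (q t)"]
    by (cases "t \<le> x") auto
  have F: "(LINT t|lborel. ?F n t) = w ^ n * (G 0 ^^ Suc n) f x" for n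
  proof -
    have "(LINT t|lborel. ?F n t) = w ^ n * G 0 ((G 0 ^^ n) f) x"
      unfolding G_def[of 0 "(G 0 ^^ n) f" x]
      by (subst set_integral_mult_right[symmetric])
        (auto simp only: set_lebesgue_integral_def mult_ac intro!: Bochner_Integration.integral_cong)
    then show ?thesis by simp
  qed
  have G: "G 0 (u w f) x = (\<Sum>n. w ^ n * (G 0 ^^ Suc n) f x)"
    using integral_suminf[OF int AE sums] unfolding eq F G_def[of 0 "u w f"] set_lebesgue_integral_def .
  \<comment> \<open>The shifted series is the Neumann series of \<open>G 0 f\<close>, again an
    admissible function.\<close>
  have "summable (\<lambda>n. w ^ n * (G 0 ^^ Suc n) f x)"
  proof -
    have "(G 0 ^^ Suc n) f x = (G 0 ^^ n) (G 0 f) x" for n by (simp only: funpow_Suc_right o_apply)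
    then show ?thesis using summable_norm_cancel[OF u_summable[OF admissible_G0[OF f]]] by simp
  qed
  from suminf_mult[OF this, of w]
  have "w * G 0 (u w f) x = (\<Sum>n. w ^ Suc n * (G 0 ^^ Suc n) f x)"
    by (simp add: G mult.assoc)
  then show ?thesis unfolding u_def N_integral(2)[OF f] by simp
qed

end

subsection \<open>The third-order equation\<close>

text \<open>All three facts come from \<open>zeta j ^ 3 = 1\<close>. They hold for every
  \<open>j\<close>, as each index above 1 denotes the root \<open>zeta 2\<close>.\<close>

lemma zeta_simps:
  shows "norm (zeta j) = 1" "zeta j ^ 3 = 1" "zeta j powi (-2) = zeta j"
proof -
  have "(complex_of_real (sqrt 3))\<^sup>2 = 3" by (metis of_real_numeral of_real_power real_sqrt_pow2 zero_le_numeral)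
  then show 3: "zeta j ^ 3 = 1"
    by (auto simp: zeta_def power3_eq_cube power2_eq_square field_simps)
  from power_eq_1_iff[OF 3] show "norm (zeta j) = 1" by simp
  from 3 have "zeta j \<noteq> 0" by auto
  then have "zeta j powi (-2) * zeta j ^ 2 = 1" by (simp add: power_int_minus)
  moreover have "zeta j * zeta j ^ 2 = 1" using 3 by (simp add: power3_eq_cube power2_eq_square mult.assoc)
  ultimately show "zeta j powi (-2) = zeta j"
    using \<open>zeta j \<noteq> 0\<close> by (metis mult_right_cancel power_not_zero)
qed

lemma zeta_sums: "zeta 0 + zeta 1 + zeta 2 = 0" "zeta 0 ^ 2 + zeta 1 ^ 2 + zeta 2 ^ 2 = 0"
proof -
  have s: "(complex_of_real (sqrt 3))\<^sup>2 = 3" by (metis of_real_numeral of_real_power real_sqrt_pow2 zero_le_numeral)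
  show "zeta 0 + zeta 1 + zeta 2 = 0" by (simp add: zeta_def field_simps)
  show "zeta 0 ^ 2 + zeta 1 ^ 2 + zeta 2 ^ 2 = 0"
    using s by (simp add: zeta_def power2_eq_square field_simps)
qed

lemma s2_eq: "s2 v = (zeta 0 * exp (zeta 0 * v) + zeta 1 * exp (zeta 1 * v) + zeta 2 * exp (zeta 2 * v)) / 3"
  by (simp add: s2_def zeta_simps(3)) (simp add: zeta_def)

lemma norm_s2_le: "norm (s2 v) \<le> exp (norm v)"
proof -
  have *: "norm (zeta j * exp (zeta j * v)) \<le> exp (norm v)" for j
    using norm_exp[of "zeta j * v"] by (simp add: norm_mult zeta_simps)
  have "norm (zeta 0 * exp (zeta 0 * v) + zeta 1 * exp (zeta 1 * v) + zeta 2 * exp (zeta 2 * v)) \<le> exp (norm v) + exp (norm v) + exp (norm v)"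
    by (intro norm_triangle_le add_mono *)
  then show ?thesis by (simp add: s2_eq norm_divide)
qed

lemma is_primitive_half_line:
  assumes g: "g \<in> borel_measurable borel" and int: "\<And>x. set_integrable lborel {..x} g"
  shows "is_primitive (\<lambda>x. LINT t:{..x}|lborel. g t) g"
  unfolding is_primitive_def
proof (intro conjI allI impI)
  fix x y :: real assume xy: "x \<le> y"
  show "set_integrable lborel {x..y} g" by (rule set_integrable_subset[OF int[of y]]) auto
  have Un: "{..y} = {..x} \<union> {x..y}" using xy by auto
  have "(LINT t:{..y}|lborel. g t) = (LINT t:{..x}|lborel. g t) + (LINT t:{x..y}|lborel. g t)"
    unfolding Un
  proof (rule set_integral_Un_AE)
    show "AE t in lborel. \<not> (t \<in> {..x} \<and> t \<in> {x..y})"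
      using AE_lborel_singleton[of x] by eventually_elim auto
    show "set_integrable lborel {..x} g" by (rule int)
    show "set_integrable lborel {x..y} g" by fact
  qed auto
  then show "(LINT t:{..y}|lborel. g t) - (LINT t:{..x}|lborel. g t) = (LINT t:{x..y}|lborel. g t)" by simp
qed (rule g)

lemma is_primitive_exp: "is_primitive (\<lambda>x. exp (\<beta> * of_real x)) (\<lambda>x. \<beta> * exp (\<beta> * of_real x))"
proof -
  have "is_primitive (\<lambda>_. 1) (\<lambda>_. 0)"
    by (simp add: is_primitive_def set_lebesgue_integral_def set_integrable_def)
  from is_primitive_exp_mult[OF this, of \<beta>] show ?thesis by simp
qed

section \<open>From the fixed-point equation to the differential equation\<close>

context volterra begin

text \<open>Differentiating a combination of the \<open>F j\<close> multiplies its coefficients by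
  \<open>\<alpha> j\<close> and adds their sum times \<open>h = q y\<close>. These sums vanish in
  the first two steps; in the third the combination returns to \<open>w ^ 3 * y\<close>, and the
  surviving \<open>w ^ 3 * h\<close> completes it to the factor \<open>1 + q\<close>.\<close>

lemma is_solution_fixpoint:
  assumes f: "admissible y" and w: "norm w \<le> c" and \<kappa>: "\<And>r. \<kappa> r = s2 (w * of_real r)"
    and eq: "\<And>x. y x = exp (w * zeta k * of_real x) + w * G 0 y x"
  obtains y1 y2 where "is_primitive y y1" "is_primitive y1 y2" "is_primitive y2 (\<lambda>x. w ^ 3 * of_real (1 + q x) * y x)"
proof -
  note [measurable] = admissibleD(1)[OF f]
  define h where "h = (\<lambda>t. of_real (q t) * y t)"
  define \<alpha> where "\<alpha> = (\<lambda>j. w * zeta j)"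
  have \<alpha>: "norm (\<alpha> j) \<le> c" for j using w by (simp add: \<alpha>_def norm_mult zeta_simps)
  define F where "F = (\<lambda>j x. LINT t:{..x}|lborel. exp (\<alpha> j * of_real (x - t)) * h t)"
  have int: "set_integrable lborel {..x} (\<lambda>t. exp (\<alpha> j * of_real (x - t)) * h t)" for j x
  proof -
    obtain C where "0 \<le> C" and C: "\<And>t. t \<le> x \<Longrightarrow> norm (y t) \<le> C * exp (c * \<bar>t\<bar>)"
      using admissibleD(2)[OF f, of x] by auto
    have "set_integrable lborel {..x} (\<lambda>t. exp (\<alpha> j * of_real (x - t)) * of_real (q t) * y t)"
    proof (rule kernel_integral_bound(1)[OF _ _ zero_le_one \<open>0 \<le> C\<close> _ C])
      fix t assume "t \<le> x"
      have "norm (exp (\<alpha> j * of_real (x - t))) \<le> exp (norm (\<alpha> j * of_real (x - t)))" by (rule norm_exp)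
      also have "\<dots> \<le> exp (c * (x - t))"
        using \<open>t \<le> x\<close> mult_right_mono[OF \<alpha>[of j], of "x - t"] by (simp add: norm_mult flip: of_real_diff)
      finally show "norm (exp (\<alpha> j * of_real (x - t))) \<le> 1 * exp (c * (x - t))" by simp
    qed measurable
    then show ?thesis by (simp add: h_def mult.assoc)
  qed
  have F: "is_primitive (F j) (\<lambda>x. \<alpha> j * F j x + h x)" for j
  proof -
    \<comment> \<open>With \<open>exp (\<alpha> j * x)\<close> pulled out of the convolution,
      \<open>x\<close> is left only in the limit of integration, and the product rule for primitives
      applies.\<close>
    let ?g = "\<lambda>t. exp (- \<alpha> j * of_real t) * h t"
    have shift: "exp (\<alpha> j * of_real (x - t)) * h t = exp (\<alpha> j * of_real x) * ?g t" for x t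
      by (simp add: algebra_simps flip: exp_add)
    have "?g \<in> borel_measurable borel" unfolding h_def by measurable
    moreover have "set_integrable lborel {..x} ?g" for x
    proof -
      have "set_integrable lborel {..x} (\<lambda>t. exp (\<alpha> j * of_real x) * ?g t)"
        using int[of x j] unfolding shift .
      then show ?thesis by (subst (asm) set_integrable_mult_right_iff) auto
    qed
    ultimately have "is_primitive (\<lambda>x. LINT t:{..x}|lborel. ?g t) ?g" by (rule is_primitive_half_line)
    from is_primitive_exp_mult[OF this, of "\<alpha> j"]
    have "is_primitive (\<lambda>x. exp (\<alpha> j * of_real x) * (LINT t:{..x}|lborel. ?g t))
      (\<lambda>x. \<alpha> j * (exp (\<alpha> j * of_real x) * (LINT t:{..x}|lborel. ?g t)) + exp (\<alpha> j * of_real x) * ?g x)" .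
    moreover have "F j = (\<lambda>x. exp (\<alpha> j * of_real x) * (LINT t:{..x}|lborel. ?g t))"
      unfolding F_def shift by simp
    moreover have "exp (\<alpha> j * of_real x) * ?g x = h x" for x by (simp flip: exp_add mult.assoc)
    ultimately show ?thesis by (simp only:)
  qed
  have G: "G 0 y x = (zeta 0 * F 0 x + zeta 1 * F 1 x + zeta 2 * F 2 x) / 3" for x
  proof -
    have K: "K 0 x t * of_real (q t) * y t = (zeta 0 * (exp (\<alpha> 0 * of_real (x - t)) * h t)
      + zeta 1 * (exp (\<alpha> 1 * of_real (x - t)) * h t) + zeta 2 * (exp (\<alpha> 2 * of_real (x - t)) * h t)) / 3" for t
      by (simp add: \<kappa> s2_eq h_def \<alpha>_def mult_ac add_divide_distrib distrib_left distrib_right)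
    show ?thesis unfolding G_def F_def K using int[of x]
      by (simp add: set_integral_add(2))
  qed
  \<comment> \<open>A family closed under differentiation up to a multiple of \<open>h\<close>; the
    term with \<open>A\<close> is the plane wave.\<close>
  define Y where "Y = (\<lambda>A c0 c1 c2 x. A * exp (w * zeta k * of_real x) + (c0 * F 0 x + c1 * F 1 x + c2 * F 2 x))"
  have Y: "is_primitive (Y A c0 c1 c2) (\<lambda>x. Y (A * (w * zeta k)) (c0 * \<alpha> 0) (c1 * \<alpha> 1) (c2 * \<alpha> 2) x + (c0 + c1 + c2) * h x)"
    for A c0 c1 c2
  proof -
    have "is_primitive (Y A c0 c1 c2) (\<lambda>x. A * (w * zeta k * exp (w * zeta k * of_real x)) +
       (c0 * (\<alpha> 0 * F 0 x + h x) + c1 * (\<alpha> 1 * F 1 x + h x) + c2 * (\<alpha> 2 * F 2 x + h x)))"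
      unfolding Y_def by (intro is_primitive_add is_primitive_cmult is_primitive_exp F)
    then show ?thesis by (simp add: Y_def algebra_simps)
  qed
  \<comment> \<open>The candidate for the derivative of order \<open>n\<close>: the coefficients in
    \<open>y\<close> itself are \<open>w * zeta j / 3\<close>, and each step multiplies them by
    \<open>w * zeta j\<close>.\<close>
  let ?Y = "\<lambda>n. Y ((w * zeta k) ^ n) (w ^ Suc n * zeta 0 ^ Suc n / 3) (w ^ Suc n * zeta 1 ^ Suc n / 3) (w ^ Suc n * zeta 2 ^ Suc n / 3)"
  have step: "is_primitive (?Y n) (\<lambda>x. ?Y (Suc n) x + w ^ Suc n * (zeta 0 ^ Suc n + zeta 1 ^ Suc n + zeta 2 ^ Suc n) / 3 * h x)" for n
    using Y[of "(w * zeta k) ^ n" "w ^ Suc n * zeta 0 ^ Suc n / 3" "w ^ Suc n * zeta 1 ^ Suc n / 3" "w ^ Suc n * zeta 2 ^ Suc n / 3"]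
    by (simp add: \<alpha>_def mult_ac add_divide_distrib distrib_left)
  \<comment> \<open>After three steps the exponent is \<open>Suc 3\<close>, so the roots are back at
    their initial power.\<close>
  have zS: "zeta j ^ Suc 3 = zeta j" for j
    by (simp only: power_Suc zeta_simps mult_1_right)
  have yx: "y x = exp (w * zeta k * of_real x) + w * ((zeta 0 * F 0 x + zeta 1 * F 1 x + zeta 2 * F 2 x) / 3)" for x
    using eq[of x] by (simp only: G)
  have y0: "?Y 0 = y" by (rule ext) (simp add: yx Y_def algebra_simps add_divide_distrib)
  have y3: "?Y 3 = (\<lambda>x. w ^ 3 * y x)"
    unfolding Y_def yx zS power_mult_distrib zeta_simps(2) power_Suc
    by (rule ext) (simp add: algebra_simps add_divide_distrib)
  show ?thesis
  proof (rule that[of "?Y 1" "?Y 2"])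
    show "is_primitive y (?Y 1)" using step[of 0] zeta_sums(1) unfolding y0 by simp
    show "is_primitive (?Y 1) (?Y 2)" using step[of 1] zeta_sums(2)
      unfolding Suc_1 by simp
    have "w ^ 3 * (zeta 0 ^ 3 + zeta 1 ^ 3 + zeta 2 ^ 3) / 3 * h x = w ^ 3 * h x" for x
      by (simp add: zeta_simps)
    then have "is_primitive (?Y 2) (\<lambda>x. w ^ 3 * y x + w ^ 3 * h x)"
      using step[of 2] y3 by (simp only: Suc_numeral semiring_norm(2,5))
    then show "is_primitive (?Y 2) (\<lambda>x. w ^ 3 * of_real (1 + q x) * y x)"
      by (simp add: h_def algebra_simps)
  qed
qed

text \<open>For \<open>x \<le> 0\<close> the factor \<open>exp (c * x)\<close> is at most 1, so
  \<open>w * G 0 y x\<close> is bounded by a multiple of \<open>P x\<close>, even where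
  \<open>y\<close> itself grows.\<close>

lemma fixpoint_tendsto:
  assumes f: "admissible y" and eq: "\<And>x. y x = f x + w * G 0 y x"
  shows "((\<lambda>x. y x - f x) \<longlongrightarrow> 0) at_bot"
proof -
  obtain C where "0 \<le> C" and C: "\<And>t. t \<le> 0 \<Longrightarrow> norm (y t) \<le> C * exp (c * \<bar>t\<bar>)"
    using admissibleD(2)[OF f, of 0] by auto
  have "eventually (\<lambda>x. norm (y x - f x) \<le> norm w * C * P x) at_bot"
    using eventually_le_at_bot[of 0]
  proof eventually_elim
    case (elim x)
    have "norm (G 0 y x) \<le> 1 * C * exp (c * x) * P x"
      unfolding G_def
    proof (rule kernel_integral_bound(3)[OF admissibleD(1)[OF f] K_meas zero_le_one \<open>0 \<le> C\<close>])
      show "norm (K 0 x t) \<le> 1 * exp (c * (x - t))" if "t \<le> x" for t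
        using that by (simp add: \<kappa>_bound)
      show "norm (y t) \<le> C * exp (c * \<bar>t\<bar>)" if "t \<le> x" for t
        using that elim by (intro C) simp
    qed
    also have "\<dots> \<le> 1 * C * 1 * P x"
      using \<open>0 \<le> C\<close> P_nonneg elim c_nonneg
      by (intro mult_right_mono mult_left_mono) (auto simp: mult_nonneg_nonpos)
    finally have "norm w * norm (G 0 y x) \<le> norm w * (C * P x)"
      by (intro mult_left_mono) auto
    then show ?case using eq[of x] by (simp add: norm_mult mult.assoc)
  qed
  moreover have "((\<lambda>x. norm w * C * P x) \<longlongrightarrow> 0) at_bot"
    using tendsto_mult_left[OF P_at_bot, of "norm w * C"] by simp
  ultimately show ?thesis by (rule Lim_null_comparison)
qed

end

section \<open>From Lebesgue to Borel measurability, and integrability of the coefficient\<close>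

lemma lebesgue_borel_representative:
  fixes f g :: "real \<Rightarrow> 'b::{banach, second_countable_topology}"
  assumes f: "f \<in> borel_measurable lebesgue" and g: "g \<in> borel_measurable borel"
    and A: "A \<in> sets borel" and AE: "AE t in lborel. f t = g t"
  shows "set_integrable lebesgue A f \<longleftrightarrow> set_integrable lborel A g"
    and "(LINT t:A|lebesgue. f t) = (LINT t:A|lborel. g t)"
proof -
  let ?f = "\<lambda>t. indicator A t *\<^sub>R f t" and ?g = "\<lambda>t. indicator A t *\<^sub>R g t"
  have g': "?g \<in> borel_measurable lborel" using g A by simp
  then have g'': "?g \<in> borel_measurable lebesgue" by (rule measurable_completion)
  have f': "?f \<in> borel_measurable lebesgue"
    using f A by (intro borel_measurable_scaleR borel_measurable_indicator) auto
  have AE': "AE t in lebesgue. ?f t = ?g t"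
    using AE_completion[OF AE] by eventually_elim simp
  show "set_integrable lebesgue A f \<longleftrightarrow> set_integrable lborel A g"
    unfolding set_integrable_def integrable_cong_AE[OF f' g'' AE'] by (rule integrable_completion[OF g'])
  show "(LINT t:A|lebesgue. f t) = (LINT t:A|lborel. g t)"
    unfolding set_lebesgue_integral_def integral_cong_AE[OF f' g'' AE'] by (rule integral_completion[OF g'])
qed

lemma set_integrable_lebesgue_bound:
  fixes f g :: "real \<Rightarrow> real"
  assumes g: "set_integrable lebesgue A g" and f: "f \<in> borel_measurable lebesgue" and A: "A \<in> sets borel"
    and le: "\<And>t. t \<in> A \<Longrightarrow> \<bar>f t\<bar> \<le> g t"
  shows "set_integrable lebesgue A f"
proof (rule set_integrable_bound[OF g])
  show "set_borel_measurable lebesgue A f"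
    unfolding set_borel_measurable_def
    using f A by (intro borel_measurable_scaleR borel_measurable_indicator) auto
  show "AE t in lebesgue. t \<in> A \<longrightarrow> norm (f t) \<le> norm (g t)"
    using le by (intro AE_I2) fastforce
qed

lemma set_integrable_exp_left_half_line:
  fixes d :: real
  assumes "0 < d"
  shows "set_integrable lebesgue {..0} (\<lambda>t. exp (- d * \<bar>t\<bar>))"
proof -
  have "set_integrable lebesgue {0..} (\<lambda>t. exp (- d * t))"
    by (rule nonnegative_absolutely_integrable_1[OF integrable_on_exp_minus_to_infinity[OF assms]]) simp
  then have "integrable lborel (\<lambda>t. indicator {0..} t *\<^sub>R exp (- d * t))"
    unfolding set_integrable_def by (subst (asm) integrable_completion) auto
  from lborel_integrable_real_affine[OF this, of "- 1" 0]
  have "integrable lborel (\<lambda>t. indicator {0..} (- t) *\<^sub>R exp (d * t))" by simp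
  moreover have "indicator {0..} (- t) *\<^sub>R exp (d * t) = indicator {..0} t *\<^sub>R exp (- d * \<bar>t\<bar>)" for t :: real
    by (auto split: split_indicator)
  ultimately have "integrable lborel (\<lambda>t. indicator {..0} t *\<^sub>R exp (- d * \<bar>t\<bar>))" by simp
  then show ?thesis unfolding set_integrable_def by (subst integrable_completion) auto
qed

text \<open>On the left, the integrand is
  \<open>\<bar>m t - m_minus\<bar> * exp (a * \<bar>t\<bar>)\<close> times
  \<open>exp (- (a - 2 * c) * \<bar>t\<bar>)\<close>, both square integrable, and
  \<open>u * v \<le> u\<^sup>2 + v\<^sup>2\<close> does the work of the Cauchy-Schwarz inequality.
  On \<open>{0..y}\<close> the weight is bounded, and the condition at \<open>+\<infinity>\<close>
  gives integrability.\<close>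

lemma set_integrable_weighted_coefficient:
  fixes m :: "real \<Rightarrow> real"
  assumes m: "m \<in> borel_measurable lebesgue"
    and plus: "set_integrable lebesgue {0..} (\<lambda>x. \<bar>m x - m_plus\<bar>\<^sup>2 * exp (2 * a * \<bar>x\<bar>))"
    and minus: "set_integrable lebesgue {..0} (\<lambda>x. \<bar>m x - m_minus\<bar>\<^sup>2 * exp (2 * a * \<bar>x\<bar>))"
    and "0 \<le> c" "2 * c < a"
  shows "set_integrable lebesgue {..x} (\<lambda>t. \<bar>m t - m_minus\<bar> * exp (2 * c * \<bar>t\<bar>))"
proof -
  have E: "(\<lambda>t. exp (b * \<bar>t\<bar>)) \<in> borel_measurable lebesgue" for b :: real
    by (rule measurable_completion) simp
  have meas: "(\<lambda>t. \<bar>m t - m_minus\<bar> * exp (2 * c * \<bar>t\<bar>)) \<in> borel_measurable lebesgue"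
    using m E by (intro borel_measurable_times borel_measurable_abs borel_measurable_diff) auto
  have amgm: "u * v \<le> u\<^sup>2 + v\<^sup>2" for u v :: real
    using sum_squares_bound[of u v] zero_le_power2[of u] zero_le_power2[of v] by linarith
  have left: "set_integrable lebesgue {..0} (\<lambda>t. \<bar>m t - m_minus\<bar> * exp (2 * c * \<bar>t\<bar>))"
  proof (rule set_integrable_lebesgue_bound[OF _ meas])
    show "set_integrable lebesgue {..0} (\<lambda>t. \<bar>m t - m_minus\<bar>\<^sup>2 * exp (2 * a * \<bar>t\<bar>) + exp (- (2 * (a - 2 * c)) * \<bar>t\<bar>))"
      using \<open>2 * c < a\<close> by (intro set_integral_add(1) minus set_integrable_exp_left_half_line) simp
    fix t :: real
    have "\<bar>m t - m_minus\<bar> * exp (2 * c * \<bar>t\<bar>) = (\<bar>m t - m_minus\<bar> * exp (a * \<bar>t\<bar>)) * exp (- (a - 2 * c) * \<bar>t\<bar>)"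
      by (simp add: mult.assoc algebra_simps flip: exp_add)
    also have "\<dots> \<le> (\<bar>m t - m_minus\<bar> * exp (a * \<bar>t\<bar>))\<^sup>2 + (exp (- (a - 2 * c) * \<bar>t\<bar>))\<^sup>2"
      by (rule amgm)
    also have "\<dots> = \<bar>m t - m_minus\<bar>\<^sup>2 * exp (2 * a * \<bar>t\<bar>) + exp (- (2 * (a - 2 * c)) * \<bar>t\<bar>)"
      by (simp add: power_mult_distrib mult.assoc flip: exp_double)
    finally show "\<bar>\<bar>m t - m_minus\<bar> * exp (2 * c * \<bar>t\<bar>)\<bar> \<le> \<dots>" by simp
  qed simp
  have right: "set_integrable lebesgue {0..y} (\<lambda>t. \<bar>m t - m_minus\<bar> * exp (2 * c * \<bar>t\<bar>))" for y
  proof (rule set_integrable_lebesgue_bound[OF _ meas])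
    have "set_integrable lebesgue {0..y} (\<lambda>x. \<bar>m x - m_plus\<bar>\<^sup>2 * exp (2 * a * \<bar>x\<bar>))"
      by (rule set_integrable_subset[OF plus]) auto
    moreover have "set_integrable lebesgue {0..y} (\<lambda>_. 1 + \<bar>m_plus - m_minus\<bar>)"
      unfolding set_integrable_def
      by (intro integrable_scaleR_left integrable_real_indicator)
        (auto simp: emeasure_lborel_Icc_eq)
    ultimately have "set_integrable lebesgue {0..y}
        (\<lambda>t. \<bar>m t - m_plus\<bar>\<^sup>2 * exp (2 * a * \<bar>t\<bar>) + (1 + \<bar>m_plus - m_minus\<bar>))"
      by (rule set_integral_add(1))
    then show "set_integrable lebesgue {0..y} (\<lambda>t. exp (2 * c * y) *
       (\<bar>m t - m_plus\<bar>\<^sup>2 * exp (2 * a * \<bar>t\<bar>) + (1 + \<bar>m_plus - m_minus\<bar>)))"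
      by (rule set_integrable_mult_right)
    fix t :: real assume t: "t \<in> {0..y}"
    \<comment> \<open>A bounded interval lets the square control the first power at the price of the
      constant 1; the triangle inequality then replaces \<open>m_plus\<close> by
      \<open>m_minus\<close>.\<close>
    have "\<bar>m t - m_plus\<bar> \<le> \<bar>m t - m_plus\<bar>\<^sup>2 + 1"
      using amgm[of "\<bar>m t - m_plus\<bar>" 1] by simp
    moreover have "\<bar>m t - m_plus\<bar>\<^sup>2 * 1 \<le> \<bar>m t - m_plus\<bar>\<^sup>2 * exp (2 * a * \<bar>t\<bar>)"
      using \<open>0 \<le> c\<close> \<open>2 * c < a\<close> by (intro mult_left_mono) auto
    ultimately have "\<bar>m t - m_minus\<bar> \<le> \<bar>m t - m_plus\<bar>\<^sup>2 * exp (2 * a * \<bar>t\<bar>) + (1 + \<bar>m_plus - m_minus\<bar>)"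
      by linarith
    moreover have "exp (2 * c * \<bar>t\<bar>) \<le> exp (2 * c * y)"
      using t \<open>0 \<le> c\<close> by (auto intro: mult_left_mono)
    ultimately have "\<bar>m t - m_minus\<bar> * exp (2 * c * \<bar>t\<bar>) \<le>
        (\<bar>m t - m_plus\<bar>\<^sup>2 * exp (2 * a * \<bar>t\<bar>) + (1 + \<bar>m_plus - m_minus\<bar>)) * exp (2 * c * y)"
      by (intro mult_mono) auto
    then show "\<bar>\<bar>m t - m_minus\<bar> * exp (2 * c * \<bar>t\<bar>)\<bar> \<le> exp (2 * c * y) *
       (\<bar>m t - m_plus\<bar>\<^sup>2 * exp (2 * a * \<bar>t\<bar>) + (1 + \<bar>m_plus - m_minus\<bar>))"
      by (simp add: mult.commute)
  qed simp
  have "set_integrable lebesgue ({..0} \<union> {0..x}) (\<lambda>t. \<bar>m t - m_minus\<bar> * exp (2 * c * \<bar>t\<bar>))"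
    using left right by (rule set_integrable_Un) auto
  then show ?thesis by (rule set_integrable_subset) auto
qed

text \<open>A change of the coefficient on a null set alters no integral, so the kernels agree for
  all \<open>x\<close> and \<open>t\<close>, not just almost all.\<close>

lemma Khat_eq_K:
  assumes "volterra \<kappa> q c" and \<kappa>: "\<And>r. \<kappa> r = s2 (\<i> * z * of_real r)"
    and m: "m \<in> borel_measurable lebesgue" and q: "AE t in lborel. m t / mm - 1 = q t"
  shows "Khat m mm (Suc n) z x t = volterra.K \<kappa> q n x t"
proof -
  interpret volterra \<kappa> q c by fact
  show ?thesis
  proof (induction n arbitrary: t)
    case 0
    show ?case by (simp only: Khat.simps K.simps \<kappa>[symmetric])
  next
    case (Suc n)
    have "Khat m mm (Suc (Suc n)) z x t = (LINT s:{t..x}|lebesgue. K n x s * of_real (m s / mm - 1) * \<kappa> (s - t))"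
      by (simp only: Khat.simps Suc.IH \<kappa>[symmetric])
    also have "\<dots> = (LINT s:{t..x}|lborel. K n x s * of_real (q s) * \<kappa> (s - t))"
    proof (rule lebesgue_borel_representative(2))
      have "K n x \<in> borel_measurable lebesgue" "(\<lambda>s. \<kappa> (s - t)) \<in> borel_measurable lebesgue"
        by (rule measurable_completion, simp)+
      then show "(\<lambda>s. K n x s * of_real (m s / mm - 1) * \<kappa> (s - t)) \<in> borel_measurable lebesgue"
        using m by (intro borel_measurable_times measurable_compose[OF _ borel_measurable_of_real]
          borel_measurable_diff borel_measurable_divide) auto
      show "AE s in lborel. K n x s * of_real (m s / mm - 1) * \<kappa> (s - t) = K n x s * of_real (q s) * \<kappa> (s - t)"
        using q by eventually_elim simp
    qed auto
    finally show ?case by simp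
  qed
qed

theorem theorem1p2:
  fixes m :: "real \<Rightarrow> real" and m_plus m_minus a n_minus :: real
    and l z :: complex and k :: nat
  assumes "m \<in> borel_measurable lebesgue"
    and "(m \<longlongrightarrow> m_plus) at_top" and "(m \<longlongrightarrow> m_minus) at_bot"
    and "0 < m_plus" and "0 < m_minus"
    and "0 < a"
    and "set_integrable lebesgue {0..} (\<lambda>x. \<bar>m x - m_plus\<bar>\<^sup>2 * exp (2 * a * \<bar>x\<bar>))"
    and "set_integrable lebesgue {..0} (\<lambda>x. \<bar>m x - m_minus\<bar>\<^sup>2 * exp (2 * a * \<bar>x\<bar>))"
    and "n_minus = root 3 m_minus"
    and "cmod l < a / (2 * n_minus)"
    and "z = l * of_real n_minus"
    and "k \<in> {0, 1, 2}"
  shows "(\<forall>n\<ge>1. \<forall>t x. t \<le> x \<longrightarrow>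
            set_integrable lebesgue {t..x}
              (\<lambda>s. Khat m m_minus n z x s * of_real (m s / m_minus - 1) * Khat m m_minus 1 z s t)) \<and>
         (\<forall>t x. t \<le> x \<longrightarrow> summable (\<lambda>n. (\<i> * z) ^ Suc n * Khat m m_minus (Suc n) z x t)) \<and>
         (\<exists>u. is_jost_minus m m_minus l k u \<and>
            (\<forall>x. set_integrable lebesgue {..x}
                   (\<lambda>t. Nhat m m_minus z x t * of_real (m t / m_minus - 1)
                        * exp (\<i> * z * zeta k * of_real t)) \<and>
                 u x = exp (\<i> * z * zeta k * of_real x)
                   + (LINT t:{..x}|lebesgue.
                        Nhat m m_minus z x t * of_real (m t / m_minus - 1)
                        * exp (\<i> * z * zeta k * of_real t))))"
proof -
  note m = assms(1)
  have n: "0 < n_minus" "n_minus ^ 3 = m_minus" using assms(5,9) by auto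
  \<comment> \<open>As \<open>c\<close> is \<open>cmod l * n_minus\<close>, the bound on
    \<open>l\<close> says precisely \<open>2 * c < a\<close>.\<close>
  define c where "c = cmod z"
  have c: "0 \<le> c" "2 * c < a"
    using assms(10) n by (auto simp: c_def assms(11) norm_mult field_simps)
  define w where "w = \<i> * z"
  have w: "cmod w = c" by (simp add: w_def c_def norm_mult)
  define \<kappa> where "\<kappa> = (\<lambda>r::real. s2 (\<i> * z * of_real r))"
  have mq: "(\<lambda>t. m t / m_minus - 1) \<in> borel_measurable lebesgue"
    using m by (intro borel_measurable_diff borel_measurable_divide) auto
  from completion_ex_borel_measurable_real[OF this]
  obtain q where q: "q \<in> borel_measurable borel" "AE t in lborel. m t / m_minus - 1 = q t"
    by auto
  have q_int: "set_integrable lborel {..x} (\<lambda>t. q t * exp (2 * c * \<bar>t\<bar>))" for x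
  proof -
    have E: "(\<lambda>t. exp (2 * c * \<bar>t\<bar>)) \<in> borel_measurable lebesgue"
      by (rule measurable_completion) simp
    have meas: "(\<lambda>t. (m t / m_minus - 1) * exp (2 * c * \<bar>t\<bar>)) \<in> borel_measurable lebesgue"
      using mq E by (rule borel_measurable_times)
    have "set_integrable lebesgue {..x} (\<lambda>t. (m t / m_minus - 1) * exp (2 * c * \<bar>t\<bar>))"
    proof (rule set_integrable_lebesgue_bound[OF _ meas])
      show "set_integrable lebesgue {..x} (\<lambda>t. (\<bar>m t - m_minus\<bar> * exp (2 * c * \<bar>t\<bar>)) / m_minus)"
        using set_integrable_weighted_coefficient[OF m assms(7,8) c, of x] by simp
      fix t
      have "m t / m_minus - 1 = (m t - m_minus) / m_minus" using assms(5) by (simp add: field_simps)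
      then show "\<bar>(m t / m_minus - 1) * exp (2 * c * \<bar>t\<bar>)\<bar> \<le> (\<bar>m t - m_minus\<bar> * exp (2 * c * \<bar>t\<bar>)) / m_minus"
        using assms(5) by (simp add: abs_mult)
    qed simp
    then show ?thesis
    proof (subst (asm) lebesgue_borel_representative(1)[OF meas])
      show "AE t in lborel. (m t / m_minus - 1) * exp (2 * c * \<bar>t\<bar>) = q t * exp (2 * c * \<bar>t\<bar>)"
        using q(2) by eventually_elim simp
    qed (use q(1) in auto)
  qed
  have vol: "volterra \<kappa> q c"
  proof
    show "\<kappa> \<in> borel_measurable borel" unfolding \<kappa>_def s2_eq by measurable
    show "norm (\<kappa> r) \<le> exp (c * r)" if "0 \<le> r" for r
      using norm_s2_le[of "\<i> * z * of_real r"] that by (simp add: \<kappa>_def c_def norm_mult)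
  qed (use c q q_int in auto)
  interpret volterra \<kappa> q c by (rule vol)
  have Khat: "Khat m m_minus (Suc n) z x t = K n x t" for n x t
    by (rule Khat_eq_K[OF vol _ m q(2)]) (simp add: \<kappa>_def)
  have Nhat: "Nhat m m_minus z = N w"
    by (rule ext)+ (simp only: Nhat_def N_def Khat w_def)
  define f where "f = (\<lambda>t::real. exp (w * zeta k * of_real t))"
  have f: "admissible f"
    unfolding admissible_def
  proof (intro conjI allI)
    show "f \<in> borel_measurable borel" unfolding f_def by measurable
    fix X :: real
    have "cmod (f t) \<le> 1 * exp (c * \<bar>t\<bar>)" for t
      using norm_exp[of "w * zeta k * of_real t"] by (simp add: f_def norm_mult zeta_simps w)
    then show "\<exists>C\<ge>0. \<forall>t\<le>X. cmod (f t) \<le> C * exp (c * \<bar>t\<bar>)" using zero_le_one by blast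
  qed
  note [measurable] = admissibleD(1)[OF f]
  have fix_u: "u w f x = f x + w * G 0 (u w f) x" for x by (rule u_fixpoint[OF f])
  have N_meas: "N w x \<in> borel_measurable borel" for x
    unfolding N_def by measurable
  have int_meas: "(\<lambda>t. N w x t * of_real (m t / m_minus - 1) * f t) \<in> borel_measurable lebesgue" for x
  proof -
    have "N w x \<in> borel_measurable lebesgue" "f \<in> borel_measurable lebesgue"
      using N_meas[of x] by (auto intro!: measurable_completion)
    then show ?thesis using mq by (intro borel_measurable_times measurable_compose[OF _ borel_measurable_of_real])
  qed
  have rep_AE: "AE t in lborel. N w x t * of_real (m t / m_minus - 1) * f t = N w x t * of_real (q t) * f t" for x
    using q(2) by eventually_elim simp
  have rep_meas: "(\<lambda>t. N w x t * of_real (q t) * f t) \<in> borel_measurable borel" for x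
    using N_meas[of x] by measurable
  note rep = lebesgue_borel_representative[OF int_meas rep_meas _ rep_AE]
  obtain y1 y2 where y: "is_primitive (u w f) y1" "is_primitive y1 y2"
      "is_primitive y2 (\<lambda>x. w ^ 3 * of_real (1 + q x) * u w f x)"
    by (rule is_solution_fixpoint[OF admissible_u[OF f], where w = w and k = k])
      (use w fix_u in \<open>auto simp: \<kappa>_def w_def f_def\<close>)
  have "is_solution m l (u w f)"
    unfolding is_solution_def
  proof (intro exI conjI allI)
    show "(u w f has_vector_derivative y1 x) (at x)" for x
      by (rule is_primitive_has_vector_derivative[OF y(1) is_primitive_continuous[OF y(2)]])
    show "(y1 has_vector_derivative y2 x) (at x)" for x
      by (rule is_primitive_has_vector_derivative[OF y(2) is_primitive_continuous[OF y(3)]])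
    show "locally_abs_continuous (u w f)" "locally_abs_continuous y1" "locally_abs_continuous y2"
      by (rule y[THEN is_primitive_locally_abs_continuous])+
    show "AE x in lebesgue. \<exists>y3. (y2 has_vector_derivative y3) (at x) \<and>
        \<i> * y3 = of_real (m x) * l ^ 3 * u w f x"
      using is_primitive_AE_has_vector_derivative[OF y(3)] AE_completion[OF q(2)]
    proof eventually_elim
      case (elim x)
      have "1 + q x = m x / m_minus" using elim(2) by simp
      \<comment> \<open>The factor \<open>\<i>\<close> of the equation and the cube of
        \<open>\<i>\<close> in \<open>w\<close> multiply to 1, and
        \<open>n_minus ^ 3 = m_minus\<close> cancels the normalisation of \<open>m\<close>.\<close>
      moreover have "\<i> * w ^ 3 = l ^ 3 * of_real m_minus"
      proof -
        have "\<i> * w ^ 3 = (\<i> * \<i> * (\<i> * \<i>)) * z ^ 3"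
          by (simp only: w_def power3_eq_cube mult_ac)
        also have "\<dots> = z ^ 3" by simp
        finally show ?thesis by (simp add: assms(11) power_mult_distrib flip: n(2))
      qed
      moreover have "complex_of_real m_minus * of_real (m x / m_minus) = of_real (m x)"
        using assms(5) by simp
      ultimately have "\<i> * (w ^ 3 * of_real (1 + q x) * u w f x) = of_real (m x) * l ^ 3 * u w f x"
        by (metis (no_types, lifting) mult.assoc mult.commute)
      then show ?case using elim(1) by blast
    qed
  qed
  moreover have "exp (\<i> * (l * of_real (root 3 m_minus)) * zeta k * of_real x) = f x" for x :: real
    by (simp add: f_def w_def assms(9,11))
  ultimately have jost: "is_jost_minus m m_minus l k (u w f)"
    unfolding is_jost_minus_def using fixpoint_tendsto[OF admissible_u[OF f] fix_u] by simp
  \<comment> \<open>This, the summability and the integrability below exclude that a kernel, the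
    series or the representation formula holds by a default value.\<close>
  have kernel: "set_integrable lebesgue {t..x}
      (\<lambda>s. Khat m m_minus n z x s * of_real (m s / m_minus - 1) * Khat m m_minus 1 z s t)"
    if "1 \<le> n" "t \<le> x" for n t x
  proof -
    obtain j where j: "n = Suc j" using \<open>1 \<le> n\<close> by (cases n) auto
    have "set_integrable lebesgue {t..x} (\<lambda>s. K j x s * of_real (m s / m_minus - 1) * \<kappa> (s - t))"
    proof (subst lebesgue_borel_representative(1))
      show "set_integrable lborel {t..x} (\<lambda>s. K j x s * of_real (q s) * \<kappa> (s - t))"
        by (rule K_integrand_integrable[OF \<open>t \<le> x\<close>])
      have "K j x \<in> borel_measurable lebesgue" "(\<lambda>s. \<kappa> (s - t)) \<in> borel_measurable lebesgue"
        by (rule measurable_completion, simp)+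
      then show "(\<lambda>s. K j x s * of_real (m s / m_minus - 1) * \<kappa> (s - t)) \<in> borel_measurable lebesgue"
        using mq by (intro borel_measurable_times measurable_compose[OF _ borel_measurable_of_real])
      show "AE s in lborel. K j x s * of_real (m s / m_minus - 1) * \<kappa> (s - t) = K j x s * of_real (q s) * \<kappa> (s - t)"
        using q(2) by eventually_elim simp
    qed auto
    then show ?thesis unfolding j One_nat_def Khat by simp
  qed
  have summable: "summable (\<lambda>n. (\<i> * z) ^ Suc n * Khat m m_minus (Suc n) z x t)" if "t \<le> x" for t x
    unfolding Khat w_def[symmetric] by (rule summable_norm_cancel[OF N_summable[OF that]])
  have N_int: "set_integrable lebesgue {..x} (\<lambda>t. N w x t * of_real (m t / m_minus - 1) * f t)" for x
    by (subst rep(1)) (auto intro: N_integral(1)[OF f])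
  have u_eq: "u w f x = f x + (LINT t:{..x}|lebesgue. N w x t * of_real (m t / m_minus - 1) * f t)" for x
    by (subst rep(2)) (auto simp: u_def)
  show ?thesis
  proof (intro conjI exI[of _ "u w f"] allI impI)
    fix n :: nat and t x :: real assume "1 \<le> n" "t \<le> x"
    then show "set_integrable lebesgue {t..x}
      (\<lambda>s. Khat m m_minus n z x s * of_real (m s / m_minus - 1) * Khat m m_minus 1 z s t)"
      by (rule kernel)
  next
    fix t x :: real assume "t \<le> x"
    then show "summable (\<lambda>n. (\<i> * z) ^ Suc n * Khat m m_minus (Suc n) z x t)" by (rule summable)
  next
    show "is_jost_minus m m_minus l k (u w f)" by (rule jost)
  next
    fix x
    show "set_integrable lebesgue {..x}
        (\<lambda>t. Nhat m m_minus z x t * of_real (m t / m_minus - 1) * exp (\<i> * z * zeta k * of_real t))"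
      unfolding Nhat using N_int[of x] by (simp only: f_def w_def)
    show "u w f x = exp (\<i> * z * zeta k * of_real x) + (LINT t:{..x}|lebesgue.
        Nhat m m_minus z x t * of_real (m t / m_minus - 1) * exp (\<i> * z * zeta k * of_real t))"
      unfolding Nhat using u_eq[of x] by (simp only: f_def w_def)
  qed
qed

end
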